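(* Let $F\in X$ be such that $x=0$ is a hyperbolic fixed point of $F$. Assume that $F$ can be $C^1$ linearized in a neighborhood of $0$. Assume that the corresponding stable and unstable manifolds $W^s$ and $W^u$ of $0$ intersect quasitransversally at a point $p\neq0$. Then for any neighborhood $\mathcal V$ of the origin there is an infinite subset $\Pi\subset\mathcal V$ with the following properties: 1) every point $q\in\Pi$ is a periodic point of $F$; 2) for any $m\in\mathbb N$ there is a point $q\in\Pi$ whose minimal period is larger than $m$; 3) $\operatorname{card}\overline\Pi=\aleph$ (the cardinality of the continuum).
   Context: Let $Q\subset\mathbb R^n$ be a bounded domain containing the origin. $X$ is the set of $C^1$ diffeomorphisms $F:\mathbb R^n\to\mathbb R^n$ with $F(\overline Q)\subset Q$, where diffeomorphisms coinciding on $\overline Q$ are identified. Quasitransversality. Two $C^1$-smooth submanifolds $W^s$ and $W^u$ of $\mathbb R^n$ intersect quasitransversally at a point $p$ if $\dim W^s+\dim W^u=n$ and there exist a neighborhood $U$ of $p$ and a $C^1$ smooth coordinate system $\xi=\operatorname{col}(\eta,\zeta)$ in $U$ with the following properties, where $w^s$ and $w^u$ denote the connected components of $W^s\cap U$ and $W^u\cap U$ containing $p$: (1) $\dim\zeta=\dim W^u$; (2) the manifolds $\{(0,\zeta)\}$ (i.e. $\{\eta=0\}$) and $w^s$ intersect transversally at $p$; (3) the mapping $\xi:U\to\xi(U)$ is a local diffeomorphism; (4) $\zeta(x)=0$ for any $x\in w^s$; (5) there exists $\delta>0$ such that $w^u$ is the graph of a function $\eta=g(\zeta)$, $|\zeta|<\delta$,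 such that $g$ is smooth for all $\zeta$ with $0<|\zeta|<\delta$. Two subsets $X^1,X^2$ of $\mathbb R^n$ intersect quasitransversally at $p$ if there is a neighborhood $U$ of $p$ such that the connected components $W^1$ and $W^2$ of $X^1\cap U$ and $X^2\cap U$ containing $p$ are $C^1$ smooth disks and intersect quasitransversally at $p$ as $C^1$-smooth submanifolds of $\mathbb R^n$, i.e. $\dim W^1+\dim W^2=n$ and there exist a neighborhood $U'$ of $p$ and a $C^1$ smooth coordinate system $\xi=\operatorname{col}(\eta,\zeta)$ in $U'$ such that, denoting by $w^1$ and $w^2$ the connected components of $W^1\cap U'$ and $W^2\cap U'$ containing $p$: $\dim\zeta=\dim W^2$; the manifolds $\{\eta=0\}$ and $w^1$ intersect transversally at $p$; the mapping $\xi:U'\to\xi(U')$ is a local diffeomorphism; $\zeta(x)=0$ for any $x\in w^1$; and there exists $\delta>0$ such that $w^2$ is the graph of a function $\eta=g(\zeta)$, $|\zeta|<\delta$, such that $g$ is smooth for all $\zeta$ with $0<|\zeta|<\delta$. *)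

theory Defs
  imports "HOL-Analysis.Analysis"
begin

section \<open>$C^1$ maps and diffeomorphisms\<close>

text \<open>
  The set \<open>S\<close> will always be open, or relatively open in a coordinate subspace. In the
  first case this is the usual notion of a $C^1$ map on \<open>S\<close>; in the second case it is the
  usual notion for the induced map on an open subset of the subspace (\<open>f' x\<close> is then only
  determined on the subspace, but a continuous choice on the whole space always exists).
\<close>

definition C1_deriv_on ::
  "('a::euclidean_space \<Rightarrow> 'b::euclidean_space) \<Rightarrow> ('a \<Rightarrow> 'a \<Rightarrow>\<^sub>L 'b) \<Rightarrow> 'a set \<Rightarrow> bool" where
  "C1_deriv_on f f' S \<longleftrightarrow>
     (\<forall>x\<in>S. (f has_derivative blinfun_apply (f' x)) (at x within S)) \<and> continuous_on S f'"

definition C1_on :: "('a::euclidean_space \<Rightarrow> 'b::euclidean_space) \<Rightarrow> 'a set \<Rightarrow> bool" where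
  "C1_on f S \<longleftrightarrow> (\<exists>f'. C1_deriv_on f f' S)"

definition C1_diffeo_on :: "'a::euclidean_space set \<Rightarrow> ('a \<Rightarrow> 'a) \<Rightarrow> bool" where
  "C1_diffeo_on U f \<longleftrightarrow>
     open U \<and> open (f ` U) \<and> inj_on f U \<and> C1_on f U \<and> C1_on (inv_into U f) (f ` U)"

section \<open>The space of diffeomorphisms\<close>

definition absorbing_diffeos :: "'a::euclidean_space set \<Rightarrow> ('a \<Rightarrow> 'a) set" where
  "absorbing_diffeos Q = {F. C1_diffeo_on UNIV F \<and> range F = UNIV \<and> F ` closure Q \<subseteq> Q}"

definition agree_on_closure ::
  "'a::euclidean_space set \<Rightarrow> (('a \<Rightarrow> 'a) \<times> ('a \<Rightarrow> 'a)) set" where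
  "agree_on_closure Q =
     {(F, G). F \<in> absorbing_diffeos Q \<and> G \<in> absorbing_diffeos Q \<and> (\<forall>x\<in>closure Q. F x = G x)}"

definition diffeo_space :: "'a::euclidean_space set \<Rightarrow> ('a \<Rightarrow> 'a) set set" where
  "diffeo_space Q = absorbing_diffeos Q // agree_on_closure Q"

section \<open>Hyperbolicity, linearization, invariant manifolds, periodic points\<close>

definition complex_eigenvalue :: "real^'n^'n \<Rightarrow> complex \<Rightarrow> bool" where
  "complex_eigenvalue A \<mu> \<longleftrightarrow>
     (\<exists>v::complex^'n. v \<noteq> 0 \<and> (\<chi> i j. complex_of_real (A $ i $ j)) *v v = \<mu> *s v)"

definition hyperbolic_fixed_point :: "(real^'n \<Rightarrow> real^'n) \<Rightarrow> real^'n \<Rightarrow> bool" where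
  "hyperbolic_fixed_point F x \<longleftrightarrow>
     F x = x \<and> F differentiable (at x) \<and>
     (\<forall>\<mu>. complex_eigenvalue (jacobian F (at x)) \<mu> \<longrightarrow> cmod \<mu> \<noteq> 1)"

text \<open>$C^1$ conjugacy, near the fixed point \<open>0\<close>, to the linear part at \<open>0\<close>.\<close>

definition C1_linearizable_at_0 :: "('a::euclidean_space \<Rightarrow> 'a) \<Rightarrow> bool" where
  "C1_linearizable_at_0 F \<longleftrightarrow>
     (\<exists>U h. 0 \<in> U \<and> C1_diffeo_on U h \<and> h 0 = 0 \<and>
        (\<forall>x\<in>U. F x \<in> U \<longrightarrow> h (F x) = frechet_derivative F (at 0) (h x)))"

definition stable_manifold :: "('a::euclidean_space \<Rightarrow> 'a) \<Rightarrow> 'a \<Rightarrow> 'a set" where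
  "stable_manifold F x = {y. (\<lambda>k. (F ^^ k) y) \<longlonglongrightarrow> x}"

definition unstable_manifold :: "('a::euclidean_space \<Rightarrow> 'a) \<Rightarrow> 'a \<Rightarrow> 'a set" where
  "unstable_manifold F x = {y. (\<lambda>k. (inv F ^^ k) y) \<longlonglongrightarrow> x}"

definition periodic_point :: "('a \<Rightarrow> 'a) \<Rightarrow> 'a \<Rightarrow> bool" where
  "periodic_point F q \<longleftrightarrow> (\<exists>k>0. (F ^^ k) q = q)"

definition minimal_period :: "('a \<Rightarrow> 'a) \<Rightarrow> 'a \<Rightarrow> nat" where
  "minimal_period F q = (LEAST k. k > 0 \<and> (F ^^ k) q = q)"

section \<open>Coordinate splittings, disks and transversality\<close>

text \<open>
  A splitting \<open>\<xi> = col(\<eta>, \<zeta>)\<close> of the coordinates is encoded by the set \<open>K\<close> of indices of the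
  \<open>\<zeta>\<close>-coordinates: \<open>\<zeta>\<close> and \<open>\<eta>\<close> are the projections \<open>coord_proj K \<xi>\<close> and
  \<open>coord_proj (- K) \<xi>\<close>, regarded as vectors of the full space, so that \<open>\<xi> = \<eta> + \<zeta>\<close> and
  \<open>dim \<zeta> = card K\<close>. In particular \<open>coord_space K\<close> is a copy of the Euclidean space of
  dimension \<open>card K\<close>.
\<close>

definition coord_space :: "'n set \<Rightarrow> (real^'n) set" where
  "coord_space K = {v. \<forall>i. i \<notin> K \<longrightarrow> v $ i = 0}"

definition coord_proj :: "'n set \<Rightarrow> real^'n \<Rightarrow> real^'n" where
  "coord_proj K v = (\<chi> i. if i \<in> K then v $ i else 0)"

text \<open>
  A $C^1$ disk of dimension \<open>k\<close>: the image of the open unit ball of dimension \<open>k\<close> under a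
  $C^1$ embedding (an immersion that is a homeomorphism onto its image).
\<close>

definition C1_disk :: "nat \<Rightarrow> (real^'n) set \<Rightarrow> bool" where
  "C1_disk k W \<longleftrightarrow>
     (\<exists>(K::'n set) \<phi> \<phi>' \<psi>. card K = k \<and>
        (let B = {v \<in> coord_space K. norm v < 1} in
           C1_deriv_on \<phi> \<phi>' B \<and>
           (\<forall>x\<in>B. inj_on (blinfun_apply (\<phi>' x)) (coord_space K)) \<and>
           homeomorphism B W \<phi> \<psi>))"

definition tangent_space :: "(real^'n) set \<Rightarrow> real^'n \<Rightarrow> (real^'n) set" where
  "tangent_space M p =
     {v. \<exists>c e. e > 0 \<and> c C1_differentiable_on {-e<..<e} \<and> c ` {-e<..<e} \<subseteq> M \<and>
           c 0 = p \<and> (c has_vector_derivative v) (at 0)}"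

definition transversal_at :: "(real^'n) set \<Rightarrow> (real^'n) set \<Rightarrow> real^'n \<Rightarrow> bool" where
  "transversal_at M N p \<longleftrightarrow>
     p \<in> M \<and> p \<in> N \<and> {v + w |v w. v \<in> tangent_space M p \<and> w \<in> tangent_space N p} = UNIV"

section \<open>Quasitransversality\<close>

text \<open>
  The definition for $C^1$ submanifolds \<open>W1\<close>, \<open>W2\<close> of dimensions \<open>k1\<close>, \<open>k2\<close>; in the notation
  for invariant manifolds, \<open>W1\<close> is $W^s$ and \<open>W2\<close> is $W^u$. The function \<open>g\<close> is only required
  to be $C^1$ away from \<open>\<zeta> = 0\<close>.
\<close>

definition quasitransversal_submanifolds ::
  "nat \<Rightarrow> nat \<Rightarrow> (real^'n) set \<Rightarrow> (real^'n) set \<Rightarrow> real^'n \<Rightarrow> bool" where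
  "quasitransversal_submanifolds k1 k2 W1 W2 p \<longleftrightarrow>
     p \<in> W1 \<and> p \<in> W2 \<and> k1 + k2 = CARD('n) \<and>
     (\<exists>U \<xi> K. p \<in> U \<and> C1_diffeo_on U \<xi> \<and> card K = k2 \<and>
        (let w1 = connected_component_set (W1 \<inter> U) p;
             w2 = connected_component_set (W2 \<inter> U) p
         in transversal_at {x \<in> U. coord_proj (- K) (\<xi> x) = 0} w1 p \<and>
            (\<forall>x\<in>w1. coord_proj K (\<xi> x) = 0) \<and>
            (\<exists>\<delta> g. \<delta> > 0 \<and>
               (\<forall>\<zeta>. g \<zeta> \<in> coord_space (- K)) \<and>
               \<xi> ` w2 = {g \<zeta> + \<zeta> |\<zeta>. \<zeta> \<in> coord_space K \<and> norm \<zeta> < \<delta>} \<and>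
               C1_on g {\<zeta> \<in> coord_space K. 0 < norm \<zeta> \<and> norm \<zeta> < \<delta>})))"

definition quasitransversal_at ::
  "(real^'n) set \<Rightarrow> (real^'n) set \<Rightarrow> real^'n \<Rightarrow> bool" where
  "quasitransversal_at X1 X2 p \<longleftrightarrow>
     p \<in> X1 \<and> p \<in> X2 \<and>
     (\<exists>U. open U \<and> p \<in> U \<and>
        (let W1 = connected_component_set (X1 \<inter> U) p;
             W2 = connected_component_set (X2 \<inter> U) p
         in \<exists>k1 k2. C1_disk k1 W1 \<and> C1_disk k2 W2 \<and>
              quasitransversal_submanifolds k1 k2 W1 W2 p))"

end

theory Submission
  imports Defs "HOL-Computational_Algebra.Fundamental_Theorem_Algebra"
begin

text \<open>
  Near the fixed point the map is conjugate to a hyperbolic linear map \<open>A\<close>, with stable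
  subspace \<open>E\<^sup>s\<close> and unstable subspace \<open>E\<^sup>u\<close>. The homoclinic point \<open>p\<close> has an iterate \<open>b\<close> in
  \<open>E\<^sup>s\<close> and a preimage \<open>a\<close> in \<open>E\<^sup>u\<close>, both close to \<open>0\<close>. An orbit that enters near \<open>b\<close> in the
  position \<open>x + A\<^sup>-\<^sup>j y\<close>, with \<open>x \<in> E\<^sup>s\<close> near \<open>b\<close> and \<open>y \<in> E\<^sup>u\<close> near \<open>a\<close>, leaves after \<open>j\<close> steps near
  \<open>a\<close> in the position \<open>A\<^sup>j x + y\<close>, and a fixed number of further steps carries it along the
  orbit of \<open>p\<close> back towards \<open>b\<close>. A periodic orbit that makes \<open>N\<close> such excursions of prescribed
  lengths \<open>j\<^sub>0, \<dots>, j\<^sub>N\<^sub>-\<^sub>1\<close> is therefore a solution of a cyclic system of \<open>N\<close> equations for the pairs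
  \<open>(x\<^sub>i, y\<^sub>i)\<close>.

  This system is solved by Brouwer's fixed point theorem. Let \<open>\<xi> = (\<eta>, \<zeta>)\<close> be the
  coordinates at \<open>p\<close> from the definition of quasitransversality, so that the stable manifold
  lies in \<open>\<zeta> = 0\<close> and the unstable manifold is a graph \<open>\<eta> = g(\<zeta>)\<close>. By invariance of
  domain \<open>x\<close> may be replaced by the value of \<open>\<eta>\<close> at the corresponding point of the stable
  manifold, and \<open>y\<close> by the value of \<open>\<zeta>\<close> at the corresponding point of the unstable manifold.
  In the limit \<open>j\<^sub>i \<rightarrow> \<infinity>\<close> the equations become \<open>\<zeta>\<^sub>i = 0\<close> and \<open>\<eta>\<^sub>i\<^sub>+\<^sub>1 = g(\<zeta>\<^sub>i)\<close>; written as a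
  fixed point problem, the limit system maps a box \<open>|\<zeta>| \<le> \<epsilon>\<close>, \<open>|\<eta>| \<le> \<epsilon>'\<close> into its half as soon
  as \<open>\<epsilon>\<close> is small compared with \<open>\<epsilon>'\<close>, and hence for large \<open>j\<^sub>i\<close> the true system maps the box
  into itself (lemmas \<open>topological_crossing\<close>, \<open>cyclic_closing\<close>, \<open>homoclinic_chains\<close>). The
  crossing of the manifolds is thus used in a topological form, which also covers a tangency at \<open>p\<close>.

  The excursion lengths are free, so time can be divided into slots of equal length \<open>L\<close> and,
  in each slot, the orbit can be made to enter near \<open>b\<close> either at the beginning of the slot or one
  step later. Every finite binary word is thus realised by a periodic orbit, and the word can be
  read off from the orbit (\<open>homoclinic_coding\<close>). Words with a single letter \<open>1\<close> give long
  minimal periods; passing to limits realises every infinite word in the closure of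
  the set of periodic points, which gives the cardinality of the continuum
  (\<open>coded_periodic_orbits\<close>).
\<close>

section \<open>The hyperbolic splitting of a linear map\<close>

text \<open>
  For a linear map \<open>f\<close> this is its stable subspace; the unstable subspace of an invertible
  \<open>f\<close> is \<open>attracted\<close> of the inverse.
\<close>

definition attracted :: "('a::real_normed_vector \<Rightarrow> 'a) \<Rightarrow> 'a set" where
  "attracted f = {v. (\<lambda>k. (f ^^ k) v) \<longlonglongrightarrow> 0}"

lemma linear_funpow:
  fixes f :: "'a::real_vector \<Rightarrow> 'a"
  assumes "linear f"
  shows "linear (f ^^ k)"
proof (induction k)
  case 0
  show ?case using linear_id by (simp add: id_def)
next
  case (Suc k)
  show ?case using linear_compose[OF Suc assms] by (simp add: o_def)
qed

lemma subspace_attracted: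
  fixes f :: "'a::real_normed_vector \<Rightarrow> 'a"
  assumes "linear f"
  shows "subspace (attracted f)"
proof -
  note l = linear_funpow[OF assms]
  show ?thesis
    unfolding subspace_def attracted_def
    by (auto simp: linear_0[OF l] linear_add[OF l] linear_cmul[OF l] intro!: tendsto_eq_intros)
qed

lemma attracted_invariant: "v \<in> attracted f \<Longrightarrow> f v \<in> attracted f"
  using LIMSEQ_Suc[of "\<lambda>k. (f ^^ k) v" 0] by (simp add: attracted_def funpow_Suc_right del: funpow.simps)

lemma funpow_inverse_cancel:
  fixes f g :: "'a \<Rightarrow> 'a"
  assumes "\<And>x. f (g x) = x"
  shows "(f ^^ k) ((g ^^ k) x) = x"
proof (induction k arbitrary: x)
  case (Suc k)
  have "(f ^^ Suc k) ((g ^^ Suc k) x) = (f ^^ k) (f (g ((g ^^ k) x)))"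
    by (simp add: funpow_swap1)
  then show ?case using assms Suc by simp
qed simp

text \<open>
  Once the error has dropped below \<open>r (1 - q) / 2\<close>, the sequence \<open>a\<close> is driven geometrically into the
  ball of radius \<open>r / 2\<close> about the origin, for any \<open>r > 0\<close>.
\<close>

lemma contracting_recursion_tendsto_0:
  fixes a :: "nat \<Rightarrow> 'a::real_normed_vector"
  assumes q: "0 \<le> q" "q < 1" and e: "e \<longlonglongrightarrow> 0"
    and rec: "\<And>k. norm (a (Suc k)) \<le> q * norm (a k) + e k"
  shows "a \<longlonglongrightarrow> 0"
proof -
  have "\<exists>N. \<forall>n\<ge>N. norm (a n) < r" if r: "r > 0" for r
  proof -
    \<comment> \<open>chosen so that \<open>r / 2\<close> is the fixed point of the majorant \<open>t \<mapsto> q t + d\<close>\<close>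
    define d where "d = r * (1 - q) / 2"
    have "d > 0" using r q by (simp add: d_def)
    then obtain N where N: "\<And>k. k \<ge> N \<Longrightarrow> e k < d"
      using e by (auto simp: LIMSEQ_iff) (meson abs_less_iff)
    have bnd: "norm (a (N + j)) \<le> q ^ j * norm (a N) + r / 2" for j
    proof (induction j)
      case 0 then show ?case using r by simp
    next
      case (Suc j)
      have "norm (a (N + Suc j)) \<le> q * norm (a (N + j)) + d"
        using rec[of "N + j"] N[of "N + j"] by simp
      also have "\<dots> \<le> q * (q ^ j * norm (a N) + r / 2) + d"
        using Suc q by (intro add_mono mult_left_mono) auto
      also have "\<dots> = q ^ Suc j * norm (a N) + r / 2"
        by (simp add: d_def field_simps)
      finally show ?case .
    qed
    have "(\<lambda>j. q ^ j * norm (a N)) \<longlonglongrightarrow> 0 * norm (a N)"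
      using q by (intro tendsto_intros LIMSEQ_power_zero) auto
    then have "eventually (\<lambda>j. q ^ j * norm (a N) < r / 2) sequentially"
      using r by (intro order_tendstoD) auto
    then obtain M where M: "\<And>j. j \<ge> M \<Longrightarrow> q ^ j * norm (a N) < r / 2"
      by (auto simp: eventually_sequentially)
    have "norm (a n) < r" if "n \<ge> N + M" for n
      using bnd[of "n - N"] M[of "n - N"] that by (simp add: le_diff_conv2)
    then show ?thesis by blast
  qed
  then show ?thesis by (simp add: LIMSEQ_iff)
qed

text \<open>
  The value \<open>p(f) v\<close>. It is defined on vectors, because the proof of the splitting works with a
  polynomial that kills one given vector.
\<close>

definition poly_apply :: "complex poly \<Rightarrow> (complex^'n \<Rightarrow> complex^'n) \<Rightarrow> complex^'n \<Rightarrow> complex^'n" where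
  "poly_apply p f v = (\<Sum>i\<le>degree p. coeff p i *s (f ^^ i) v)"

lemma poly_apply_bound:
  assumes "degree p \<le> N"
  shows "poly_apply p f v = (\<Sum>i\<le>N. coeff p i *s (f ^^ i) v)"
  unfolding poly_apply_def
  by (rule sum.mono_neutral_left) (use assms in \<open>auto simp: coeff_eq_0\<close>)

lemma vec_linear_funpow:
  fixes f :: "complex^'n \<Rightarrow> complex^'n"
  assumes "Vector_Spaces.linear (*s) (*s) f"
  shows "Vector_Spaces.linear (*s) (*s) (f ^^ k)"
proof (induction k)
  case 0
  then show ?case using vec.linear_id by (simp add: id_def)
next
  case (Suc k)
  then show ?case using Vector_Spaces.linear_compose[OF Suc assms] by (simp add: o_def)
qed

lemma poly_apply_linear_factor:
  fixes f :: "complex^'n \<Rightarrow> complex^'n"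
  assumes f: "Vector_Spaces.linear (*s) (*s) f"
  shows "poly_apply ([:- \<mu>, 1:] * q) f v = poly_apply q f (f v - \<mu> *s v)"
proof -
  note l = vec_linear_funpow[OF f]
  define N where "N = degree q"
  have deg: "degree ([:- \<mu>, 1:] * q) \<le> Suc N"
    using degree_mult_le[of "[:- \<mu>, 1:]" q] by (simp add: N_def)
  have c: "coeff ([:- \<mu>, 1:] * q) i = (if i = 0 then 0 else coeff q (i - 1)) - \<mu> * coeff q i" for i
    by (cases i) (simp_all add: coeff_pCons)
  have "poly_apply ([:- \<mu>, 1:] * q) f v =
     (\<Sum>i\<le>Suc N. (if i = 0 then 0 else coeff q (i - 1)) *s (f ^^ i) v) - (\<Sum>i\<le>Suc N. (\<mu> * coeff q i) *s (f ^^ i) v)"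
    unfolding poly_apply_bound[OF deg] c by (simp add: vec.scale_left_diff_distrib sum_subtractf)
  also have "(\<Sum>i\<le>Suc N. (if i = 0 then 0 else coeff q (i - 1)) *s (f ^^ i) v) = (\<Sum>i\<le>N. coeff q i *s (f ^^ i) (f v))"
    by (subst sum.atMost_Suc_shift) (simp add: funpow_Suc_right del: funpow.simps)
  also have "(\<Sum>i\<le>Suc N. (\<mu> * coeff q i) *s (f ^^ i) v) = (\<Sum>i\<le>N. (\<mu> * coeff q i) *s (f ^^ i) v)"
    by (simp add: N_def coeff_eq_0)
  also have "(\<Sum>i\<le>N. coeff q i *s (f ^^ i) (f v)) - (\<Sum>i\<le>N. (\<mu> * coeff q i) *s (f ^^ i) v)
      = (\<Sum>i\<le>N. coeff q i *s (f ^^ i) (f v - \<mu> *s v))"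
    by (simp add: Vector_Spaces.linear.axioms sum_subtractf[symmetric] vec.linear_diff[OF l] vec.linear_scale[OF l] vec.scale_right_diff_distrib mult.commute)
  finally show ?thesis by (simp add: poly_apply_def N_def)
qed

text \<open>
  The \<open>n + 1\<close> vectors \<open>v, f v, \<dots>, f\<^sup>n v\<close> in an \<open>n\<close>-dimensional space are linearly dependent, and
  a dependency is a polynomial. If two of them coincide, the set of these vectors may still be
  independent, and the polynomial is then a difference of two monomials.
\<close>

lemma annihilating_poly_exists:
  fixes f :: "complex^'n \<Rightarrow> complex^'n"
  shows "\<exists>p. p \<noteq> 0 \<and> poly_apply p f v = 0"
proof (cases "inj_on (\<lambda>i. (f ^^ i) v) {..CARD('n)}")
  case False
  then obtain i j where ij: "i \<noteq> j" "(f ^^ i) v = (f ^^ j) v" by (auto simp: inj_on_def)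
  define p where "p = monom (1::complex) i - monom 1 j"
  have "coeff p i = 1" using ij by (simp add: p_def)
  then have "p \<noteq> 0" by auto
  have "degree p \<le> max i j"
    unfolding p_def using degree_monom_le[of "1::complex"] by (meson degree_diff_le_max le_trans max.mono)
  from poly_apply_bound[OF this, of f v] have "poly_apply p f v = (\<Sum>k\<le>max i j. (if k = i then (f ^^ i) v else 0) - (if k = j then (f ^^ j) v else 0))"
    by (simp add: p_def vec.scale_left_diff_distrib if_distrib[of "\<lambda>c. c *s _"] eq_commute[of _ i] eq_commute[of _ j] cong: if_cong)
  also have "\<dots> = 0" using ij by (simp add: sum_subtractf)
  finally show ?thesis using \<open>p \<noteq> 0\<close> by blast
next
  case True
  let ?S = "(\<lambda>i. (f ^^ i) v) ` {..CARD('n)}"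
  have "card ?S = Suc CARD('n)" using card_image[OF True] by simp
  then have "vec.dependent ?S"
    by (metis vec.dim_eq_card_independent vec.dim_subset_UNIV vec.dimension_def card_cart_basis not_less_eq_eq order_refl)
  then obtain u w where u: "(\<Sum>x\<in>?S. u x *s x) = 0" and w: "w \<in> ?S" "u w \<noteq> 0"
    by (auto simp: vec.dependent_finite)
  define p where "p = (\<Sum>i\<le>CARD('n). monom (u ((f ^^ i) v)) i)"
  have cp: "coeff p i = (if i \<le> CARD('n) then u ((f ^^ i) v) else 0)" for i
    by (simp add: p_def coeff_sum)
  obtain i where "i \<le> CARD('n)" "w = (f ^^ i) v" using w(1) by auto
  then have "coeff p i \<noteq> 0" using w(2) cp by simp
  then have "p \<noteq> 0" by auto
  have "degree p \<le> CARD('n)" by (rule degree_le) (simp add: cp)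
  from poly_apply_bound[OF this] have "poly_apply p f v = (\<Sum>i\<le>CARD('n). u ((f ^^ i) v) *s (f ^^ i) v)"
    by (simp add: cp)
  also have "\<dots> = 0" using u by (simp add: sum.reindex[OF True] o_def)
  finally show ?thesis using \<open>p \<noteq> 0\<close> by blast
qed

lemma vec_linear_imp_real_linear:
  fixes f :: "complex^'n \<Rightarrow> complex^'n"
  assumes "Vector_Spaces.linear (*s) (*s) f"
  shows "linear f"
proof
  fix r :: real and x y :: "complex^'n"
  show "f (x + y) = f x + f y" by (rule vec.linear_add[OF assms])
  have "r *\<^sub>R z = complex_of_real r *s z" for z :: "complex^'n"
    by (vector scaleR_conv_of_real)
  then show "f (r *\<^sub>R x) = r *\<^sub>R f x"
    by (simp add: vec.linear_scale[OF assms])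
qed

lemma norm_vector_scalar_mult:
  fixes v :: "complex^'n"
  shows "norm (c *s v) = cmod c * norm v"
  by (simp add: norm_vec_def norm_mult L2_set_right_distrib)

lemma attracted_scale:
  fixes f :: "complex^'n \<Rightarrow> complex^'n"
  assumes f: "Vector_Spaces.linear (*s) (*s) f" and v: "v \<in> attracted f"
  shows "c *s v \<in> attracted f"
proof -
  have "(\<lambda>k. cmod c * norm ((f ^^ k) v)) \<longlonglongrightarrow> cmod c * 0"
    using v by (intro tendsto_intros tendsto_norm_zero) (simp add: attracted_def)
  then show ?thesis
    unfolding attracted_def mem_Collect_eq vec.linear_scale[OF vec_linear_funpow[OF f]]
    by (intro tendsto_norm_zero_cancel[of "\<lambda>k. c *s (f ^^ k) v"]) (simp add: norm_vector_scalar_mult)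
qed

lemma attracted_eigenvector_0:
  fixes f :: "complex^'n \<Rightarrow> complex^'n"
  assumes f: "Vector_Spaces.linear (*s) (*s) f" and x: "x \<in> attracted f"
    and ev: "f x = \<mu> *s x" and \<mu>: "cmod \<mu> \<ge> 1"
  shows "x = 0"
proof -
  have pow: "(f ^^ k) x = \<mu> ^ k *s x" for k
    by (induction k) (simp_all add: vec.linear_scale[OF f] ev mult.commute)
  have "norm x \<le> norm ((f ^^ k) x)" for k
    using \<mu> mult_right_mono[of 1 "cmod \<mu> ^ k" "norm x"]
    by (simp add: pow norm_vector_scalar_mult norm_power)
  then have "norm x \<le> 0"
    using x by (intro LIMSEQ_le_const[OF tendsto_norm_zero]) (auto simp: attracted_def)
  then show ?thesis by simp
qed

text \<open>
  An eigenvector for an eigenvalue of modulus at least \<open>1\<close> is not attracted to \<open>0\<close>. Hence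
  \<open>f - \<mu>\<close> is injective on the invariant subspace of attracted vectors, and so surjective on it by
  finite dimension.
\<close>

lemma attracted_solve:
  fixes f :: "complex^'n \<Rightarrow> complex^'n"
  assumes f: "Vector_Spaces.linear (*s) (*s) f" and \<mu>: "cmod \<mu> \<ge> 1" and w: "w \<in> attracted f"
  shows "\<exists>x\<in>attracted f. f x - \<mu> *s x = w"
proof -
  define T where "T = (\<lambda>x. f x - \<mu> *s x)"
  note sub = subspace_attracted[OF vec_linear_imp_real_linear[OF f]]
  have "Vector_Spaces.linear (*s) (*s) T"
    unfolding T_def by (intro vec.linear_compose_sub f vec.linear_scale_self)
  then have T: "linear T" by (rule vec_linear_imp_real_linear)
  have inj: "inj_on T (attracted f)"
  proof (rule inj_onI)
    fix x y assume xy: "x \<in> attracted f" "y \<in> attracted f" "T x = T y"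
    have "f (x - y) = \<mu> *s (x - y)"
      using xy(3) by (simp add: T_def vec.linear_diff[OF f] vec.scale_right_diff_distrib algebra_simps)
    then have "x - y = 0"
      using attracted_eigenvector_0[OF f _ _ \<mu>] subspace_diff[OF sub xy(1,2)] by blast
    then show "x = y" by simp
  qed
  have into: "T ` attracted f \<subseteq> attracted f"
    by (auto simp: T_def intro!: subspace_diff[OF sub] attracted_invariant attracted_scale[OF f])
  have "dim (T ` attracted f) = dim (attracted f)"
    using dim_image_eq[OF T] inj sub by (metis span_eq_iff)
  then have "T ` attracted f = attracted f"
    by (intro subspace_dim_equal into sub linear_subspace_image T) auto
  then show ?thesis using w by (force simp: T_def image_iff)
qed

text \<open>
  The iterates \<open>a\<^sub>k = f\<^sup>k y\<close> satisfy \<open>a\<^sub>k\<^sub>+\<^sub>1 = \<mu> a\<^sub>k + f\<^sup>k w\<close>, a contracting recursion with an error that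
  tends to \<open>0\<close>.
\<close>

lemma attracted_quotient_eigenvector:
  fixes f :: "complex^'n \<Rightarrow> complex^'n"
  assumes f: "Vector_Spaces.linear (*s) (*s) f" and \<mu>: "cmod \<mu> < 1"
    and w: "w \<in> attracted f" and y: "f y = \<mu> *s y + w"
  shows "y \<in> attracted f"
proof -
  note l = vec_linear_funpow[OF f]
  have "(f ^^ Suc k) y = \<mu> *s (f ^^ k) y + (f ^^ k) w" for k
    by (simp add: funpow_Suc_right y vec.linear_add[OF l] vec.linear_scale[OF l] del: funpow.simps)
  then have "norm ((f ^^ Suc k) y) \<le> cmod \<mu> * norm ((f ^^ k) y) + norm ((f ^^ k) w)" for k
    by (metis norm_triangle_ineq norm_vector_scalar_mult)
  moreover have "(\<lambda>k. norm ((f ^^ k) w)) \<longlonglongrightarrow> 0"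
    using w by (intro tendsto_norm_zero) (simp add: attracted_def)
  ultimately have "(\<lambda>k. (f ^^ k) y) \<longlonglongrightarrow> 0"
    using contracting_recursion_tendsto_0[of "cmod \<mu>" "\<lambda>k. norm ((f ^^ k) w)" "\<lambda>k. (f ^^ k) y"] \<mu> by simp
  then show ?thesis by (simp add: attracted_def)
qed

text \<open>
  Induction on the degree of a polynomial \<open>p = (X - \<mu>) q\<close> with \<open>p(f) v = 0\<close>. The vector
  \<open>w = (f - \<mu>) v\<close> is killed by \<open>q\<close> and so splits as \<open>w = s + u\<close>. If \<open>|\<mu>| < 1\<close>, then \<open>f - \<mu>\<close>
  can be inverted on the unstable subspace, which removes \<open>u\<close>; what remains of \<open>v\<close> is
  an eigenvector modulo the stable subspace, hence stable. The case \<open>|\<mu>| > 1\<close> is symmetric. If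
  \<open>|\<mu>| = 1\<close>, both components can be removed, and what remains is an eigenvector for
  \<open>\<mu>\<close>, which is \<open>0\<close> by hyperbolicity.
\<close>

lemma hyperbolic_splitting_complex:
  fixes f g :: "complex^'n \<Rightarrow> complex^'n"
  assumes f: "Vector_Spaces.linear (*s) (*s) f" and g: "Vector_Spaces.linear (*s) (*s) g"
    and fg: "\<And>x. f (g x) = x" and gf: "\<And>x. g (f x) = x"
    and hyp: "\<And>\<mu> v. f v = \<mu> *s v \<Longrightarrow> v \<noteq> 0 \<Longrightarrow> cmod \<mu> \<noteq> 1"
  shows "\<exists>s\<in>attracted f. \<exists>u\<in>attracted g. v = s + u"
proof -
  note subf = subspace_attracted[OF vec_linear_imp_real_linear[OF f]]
  note subg = subspace_attracted[OF vec_linear_imp_real_linear[OF g]]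
  have solve_g: "\<exists>x\<in>attracted g. f x - \<mu> *s x = w" if \<mu>: "cmod \<mu> \<le> 1" and w: "w \<in> attracted g" for \<mu> w
  proof (cases "\<mu> = 0")
    case True
    then show ?thesis using attracted_invariant[OF w] fg by (intro bexI[of _ "g w"]) auto
  next
    case False
    have "cmod (inverse \<mu>) \<ge> 1"
      using \<mu> False by (simp add: norm_inverse one_le_inverse_iff)
    \<comment> \<open>with \<open>y = f x\<close> the equation becomes \<open>g y - \<mu>\<inverse> y = - \<mu>\<inverse> w\<close>\<close>
    from attracted_solve[OF g this, of "- inverse \<mu> *s w"] attracted_scale[OF g w]
    obtain y where y: "y \<in> attracted g" "g y - inverse \<mu> *s y = - inverse \<mu> *s w" by blast
    then have "\<mu> *s (g y - inverse \<mu> *s y) = \<mu> *s (- inverse \<mu> *s w)" by simp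
    then have "\<mu> *s g y - y = - w"
      using False by (simp add: vec.scale_right_diff_distrib)
    then have "f (g y) - \<mu> *s g y = w"
      by (simp add: fg algebra_simps)
    then show ?thesis using attracted_invariant[OF y(1)] by blast
  qed
  have main: "\<exists>s\<in>attracted f. \<exists>u\<in>attracted g. v = s + u"
    if "p \<noteq> 0" "poly_apply p f v = 0" for p v
    using that
  proof (induction "degree p" arbitrary: p v)
    case 0
    then obtain c where "p = [:c:]" by (metis degree_eq_zeroE)
    then have "v = 0" using 0 by (simp add: poly_apply_def)
    then show ?case using subspace_0[OF subf] subspace_0[OF subg] by force
  next
    case (Suc d)
    have "\<not> constant (poly p)" using Suc.hyps(2) by (simp add: constant_degree)
    then obtain \<mu> where "poly p \<mu> = 0" using fundamental_theorem_of_algebra by blast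
    then obtain q where q: "p = [:- \<mu>, 1:] * q" by (auto simp: poly_eq_0_iff_dvd elim: dvdE)
    then have "q \<noteq> 0" using Suc.prems by auto
    have "degree p = degree [:- \<mu>, 1:] + degree q"
      unfolding q by (rule degree_mult_eq) (use \<open>q \<noteq> 0\<close> in auto)
    then have "d = degree q" using Suc.hyps(2) by simp
    from Suc.hyps(1)[OF this \<open>q \<noteq> 0\<close>, of "f v - \<mu> *s v"] Suc.prems(2)
    obtain s u where su: "s \<in> attracted f" "u \<in> attracted g" "f v - \<mu> *s v = s + u"
      unfolding q poly_apply_linear_factor[OF f] by blast
    have fv: "f v = \<mu> *s v + s + u" using su(3) by (simp add: algebra_simps)
    consider "cmod \<mu> < 1" | "cmod \<mu> > 1" | "cmod \<mu> = 1" by linarith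
    then show ?case
    proof cases
      case 1
      then obtain x where x: "x \<in> attracted g" "f x - \<mu> *s x = u" using solve_g su(2) by force
      have fx: "f x = \<mu> *s x + u" using x(2) by (simp add: algebra_simps)
      have "f (v - x) = \<mu> *s (v - x) + s"
        by (simp add: vec.linear_diff[OF f] fv fx vec.scale_right_diff_distrib)
      then have "v - x \<in> attracted f" using attracted_quotient_eigenvector[OF f 1 su(1)] by blast
      then show ?thesis using x(1) by force
    next
      case 2
      then obtain x where x: "x \<in> attracted f" "f x - \<mu> *s x = s"
        using attracted_solve[OF f _ su(1)] by force
      have fx: "f x = \<mu> *s x + s" using x(2) by (simp add: algebra_simps)
      define y where "y = v - x"
      have "f y = \<mu> *s y + u"
        by (simp add: y_def vec.linear_diff[OF f] fv fx vec.scale_right_diff_distrib)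
      then have "g (f y) = \<mu> *s g y + g u" by (simp add: vec.linear_add[OF g] vec.linear_scale[OF g])
      then have "inverse \<mu> *s y = inverse \<mu> *s (\<mu> *s g y + g u)" by (simp add: gf)
      moreover have "\<mu> \<noteq> 0" using 2 by auto
      ultimately have "g y = inverse \<mu> *s y + (- inverse \<mu>) *s g u"
        by (simp add: vec.scale_right_distrib)
      moreover have "cmod (inverse \<mu>) < 1" using 2 by (simp add: norm_inverse inverse_less_1_iff)
      ultimately have "y \<in> attracted g"
        using attracted_quotient_eigenvector[OF g] attracted_scale[OF g attracted_invariant[OF su(2)]] by blast
      then show ?thesis using x(1) by (force simp: y_def)
    next
      case 3
      then obtain x where x: "x \<in> attracted f" "f x - \<mu> *s x = s"
        using attracted_solve[OF f _ su(1)] by force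
      obtain y where y: "y \<in> attracted g" "f y - \<mu> *s y = u" using solve_g su(2) 3 by force
      have fx: "f x = \<mu> *s x + s" "f y = \<mu> *s y + u" using x(2) y(2) by (simp_all add: algebra_simps)
      have "f (v - x - y) = \<mu> *s (v - x - y)"
        by (simp add: vec.linear_diff[OF f] fv fx vec.scale_right_diff_distrib)
      then have "v - x - y = 0" using hyp 3 by blast
      then have "v = x + y" by (simp add: algebra_simps)
      then show ?thesis using x(1) y(1) by blast
    qed
  qed
  show ?thesis using annihilating_poly_exists[of f v] main by blast
qed

definition complexify :: "(real^'n \<Rightarrow> real^'n) \<Rightarrow> complex^'n \<Rightarrow> complex^'n" where
  "complexify f v = (\<chi> i. Complex (f (\<chi> j. Re (v $ j)) $ i) (f (\<chi> j. Im (v $ j)) $ i))"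

lemma complexify_linear:
  fixes f :: "real^'n \<Rightarrow> real^'n"
  assumes "linear f"
  shows "Vector_Spaces.linear (*s) (*s) (complexify f)"
proof
  fix c :: complex and x y :: "complex^'n"
  note simps = linear_add[OF assms] linear_diff[OF assms] linear_scale[OF assms]
  have [simp]: "(\<chi> j. Re (x $ j) + Re (y $ j)) = (\<chi> j. Re (x $ j)) + (\<chi> j. Re (y $ j))"
    "(\<chi> j. Im (x $ j) + Im (y $ j)) = (\<chi> j. Im (x $ j)) + (\<chi> j. Im (y $ j))"
    by (simp_all add: vec_eq_iff)
  show "complexify f (x + y) = complexify f x + complexify f y"
    by (simp add: complexify_def vec_eq_iff complex_eq_iff simps)
  have [simp]: "(\<chi> j. Re c * Re (x $ j) - Im c * Im (x $ j)) = Re c *\<^sub>R (\<chi> j. Re (x $ j)) - Im c *\<^sub>R (\<chi> j. Im (x $ j))"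
    "(\<chi> j. Re c * Im (x $ j) + Im c * Re (x $ j)) = Re c *\<^sub>R (\<chi> j. Im (x $ j)) + Im c *\<^sub>R (\<chi> j. Re (x $ j))"
    by (simp_all add: vec_eq_iff)
  show "complexify f (c *s x) = c *s complexify f x"
    by (simp add: complexify_def vec_eq_iff complex_eq_iff simps)
qed

lemma complexify_inverse:
  assumes "\<And>x. f (g x) = x"
  shows "complexify f (complexify g x) = x"
  by (simp add: complexify_def vec_eq_iff complex_eq_iff assms)

lemma complexify_matrix:
  fixes f :: "real^'n \<Rightarrow> real^'n"
  assumes "linear f"
  shows "complexify f v = (\<chi> i j. complex_of_real (matrix f $ i $ j)) *v v"
proof -
  have f: "f x $ i = (\<Sum>j\<in>UNIV. matrix f $ i $ j * x $ j)" for x i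
    using fun_cong[OF matrix_vector_mul(2)[OF assms], of x] by (metis (no_types) matrix_vector_mult_def vec_lambda_beta)
  show ?thesis
    by (simp add: complexify_def matrix_vector_mult_def vec_eq_iff complex_eq_iff f)
qed

lemma attracted_complexify_Re:
  assumes "v \<in> attracted (complexify f)"
  shows "(\<chi> i. Re (v $ i)) \<in> attracted f"
proof -
  have iter: "(\<chi> i. Re ((complexify f ^^ k) v $ i)) = (f ^^ k) (\<chi> i. Re (v $ i))" for k
  proof (induction k)
    case (Suc k)
    have "(\<chi> i. Re (complexify f w $ i)) = f (\<chi> i. Re (w $ i))" for w
      by (simp add: complexify_def vec_eq_iff)
    then show ?case using Suc by simp
  qed simp
  have "(\<lambda>k. \<chi> i. Re ((complexify f ^^ k) v $ i)) \<longlonglongrightarrow> (\<chi> i. Re ((0 :: complex^'a) $ i))"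
    using assms unfolding attracted_def by (intro tendsto_intros) simp
  then show ?thesis by (simp add: iter attracted_def zero_vec_def)
qed

text \<open>
  The complex splitting of a real vector has real parts in the real stable and unstable
  subspaces.
\<close>

lemma hyperbolic_splitting:
  fixes f g :: "real^'n \<Rightarrow> real^'n"
  assumes f: "linear f" and g: "linear g"
    and fg: "\<And>x. f (g x) = x" and gf: "\<And>x. g (f x) = x"
    and hyp: "\<And>\<mu>. complex_eigenvalue (matrix f) \<mu> \<Longrightarrow> cmod \<mu> \<noteq> 1"
  shows "\<exists>s\<in>attracted f. \<exists>u\<in>attracted g. v = s + u"
proof -
  have ev: "cmod \<mu> \<noteq> 1" if "complexify f w = \<mu> *s w" "w \<noteq> 0" for \<mu> and w :: "complex^'n"
    using hyp that by (auto simp: complex_eigenvalue_def complexify_matrix[OF f])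
  have "\<exists>s\<in>attracted (complexify f). \<exists>u\<in>attracted (complexify g). (\<chi> i. complex_of_real (v $ i)) = s + u"
    by (rule hyperbolic_splitting_complex[OF complexify_linear[OF f] complexify_linear[OF g]
      complexify_inverse[of f g, OF fg] complexify_inverse[of g f, OF gf]]) (use ev in blast)
  then obtain s u :: "complex^'n" where su: "s \<in> attracted (complexify f)" "u \<in> attracted (complexify g)"
    "(\<chi> i. complex_of_real (v $ i)) = s + u" by blast
  have "v = (\<chi> i. Re (s $ i)) + (\<chi> i. Re (u $ i))"
    using su(3) by (simp add: vec_eq_iff) (metis Re_complex_of_real plus_complex.sel(1))
  then show ?thesis using attracted_complexify_Re su by blast
qed

text \<open>
  Pointwise convergence of \<open>f\<^sup>k\<close> to \<open>0\<close> on an orthonormal basis bounds the norm of \<open>f\<^sup>k\<close> on the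
  whole stable subspace.
\<close>

lemma attracted_uniform:
  fixes f :: "'a::euclidean_space \<Rightarrow> 'a"
  assumes f: "linear f"
  obtains c where "c \<longlonglongrightarrow> 0" "\<And>k x. x \<in> attracted f \<Longrightarrow> norm ((f ^^ k) x) \<le> c k * norm x"
proof -
  note l = linear_funpow[OF f]
  obtain B where B: "B \<subseteq> attracted f" "pairwise orthogonal B" "\<And>x. x \<in> B \<Longrightarrow> norm x = 1"
    "independent B" "card B = dim (attracted f)" "span B = attracted f"
    using orthonormal_basis_subspace[OF subspace_attracted[OF f]] by metis
  have fin: "finite B" using B(4) by (rule independent_imp_finite)
  define c where "c k = (\<Sum>b\<in>B. norm ((f ^^ k) b))" for k
  have "c \<longlonglongrightarrow> (\<Sum>b\<in>B. 0)"
    unfolding c_def using B(1) by (intro tendsto_sum tendsto_norm_zero) (auto simp: attracted_def)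
  moreover have "norm ((f ^^ k) x) \<le> c k * norm x" if x: "x \<in> attracted f" for k x
  proof -
    have "(\<Sum>b\<in>B. (x \<bullet> b) *\<^sub>R b) = x"
      by (rule orthonormal_basis_expand) (use B x fin in auto)
    then have "(f ^^ k) x = (f ^^ k) (\<Sum>b\<in>B. (x \<bullet> b) *\<^sub>R b)" by simp
    also have "\<dots> = (\<Sum>b\<in>B. (x \<bullet> b) *\<^sub>R (f ^^ k) b)"
      by (simp add: linear_sum[OF l] linear_cmul[OF l])
    finally have "norm ((f ^^ k) x) \<le> (\<Sum>b\<in>B. \<bar>x \<bullet> b\<bar> * norm ((f ^^ k) b))"
      by (metis (mono_tags, lifting) norm_scaleR norm_sum order_refl sum_norm_le)
    also have "\<dots> \<le> (\<Sum>b\<in>B. norm x * norm ((f ^^ k) b))"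
    proof (intro sum_mono mult_right_mono norm_ge_zero)
      fix b assume "b \<in> B"
      then show "\<bar>x \<bullet> b\<bar> \<le> norm x" using Cauchy_Schwarz_ineq2[of x b] B(3) by simp
    qed
    finally show ?thesis by (simp add: c_def sum_distrib_left mult.commute)
  qed
  ultimately show ?thesis using that by simp
qed

section \<open>Brouwer's theorem for cyclic systems of equations\<close>

lemma tendsto_funI:
  fixes X :: "'b \<Rightarrow> 'i \<Rightarrow> 'a::topological_space"
  assumes "\<And>i. ((\<lambda>n. X n i) \<longlongrightarrow> x i) F"
  shows "(X \<longlongrightarrow> x) F"
proof -
  have "limitin (product_topology (\<lambda>i. euclidean) UNIV) X x F"
    by (subst limitin_componentwise) (use assms in auto)
  then show ?thesis by (simp add: euclidean_product_topology)
qed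

lemma compact_Pi_UNIV:
  fixes S :: "'i \<Rightarrow> 'a::topological_space set"
  assumes "\<And>i. compact (S i)"
  shows "compact (PiE UNIV S)"
proof -
  have "compactin (product_topology (\<lambda>i. euclidean) UNIV) (PiE UNIV S)"
    by (subst compactin_PiE) (use assms in auto)
  then show ?thesis by (simp add: euclidean_product_topology)
qed

text \<open>
  The number of equations of the cyclic system is the number of excursions of the orbit, an
  arbitrary natural number. The fixed point theorem is therefore needed on cubes of
  variable dimension, rendered as functions on an index set, and not for a fixed Euclidean type.

  Kuhn's lemma provides, for each mesh \<open>1 / (p + 1)\<close>, a small grid cell that has in each direction \<open>i\<close> a
  vertex where \<open>f\<close> moves the coordinate \<open>i\<close> up and one where \<open>f\<close> moves it down. A limit of such cells is
  a fixed point.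
\<close>

lemma brouwer_unit_cube:
  fixes f :: "(nat \<Rightarrow> real) \<Rightarrow> nat \<Rightarrow> real" and n :: nat
  defines "C \<equiv> {x. \<forall>i. if i < n then x i \<in> {0..1} else x i = 0}"
  assumes cont: "\<And>i. i < n \<Longrightarrow> continuous_on C (\<lambda>x. f x i)"
    and maps: "\<And>x i. x \<in> C \<Longrightarrow> i < n \<Longrightarrow> f x i \<in> {0..1}"
  shows "\<exists>x\<in>C. \<forall>i<n. f x i = x i"
proof -
  have "C = PiE UNIV (\<lambda>i. if i < n then {0..1} else {0})"
    by (auto simp: C_def PiE_def Pi_def split: if_splits)
  then have "compact C" by (simp add: compact_Pi_UNIV)
  then have seq: "seq_compact C" by (rule compact_imp_seq_compact)
  \<comment> \<open>the other coordinates are frozen at \<open>0\<close>, so that \<open>f'\<close> maps \<open>C\<close> into itself\<close>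
  define f' where "f' x i = (if i < n then f x i else 0)" for x i
  have "\<exists>l. (\<forall>x i. l x i \<le> (1::nat)) \<and>
      (\<forall>x i. x \<in> C \<and> i < n \<and> x i = 0 \<longrightarrow> l x i = 0) \<and>
      (\<forall>x i. x \<in> C \<and> i < n \<and> x i = 1 \<longrightarrow> l x i = 1) \<and>
      (\<forall>x i. x \<in> C \<and> i < n \<and> l x i = 0 \<longrightarrow> x i \<le> f' x i) \<and>
      (\<forall>x i. x \<in> C \<and> i < n \<and> l x i = 1 \<longrightarrow> f' x i \<le> x i)"
    by (rule kuhn_labelling_lemma') (use maps in \<open>auto simp: f'_def C_def\<close>)
  then obtain l where l: "\<forall>x i. l x i \<le> (1::nat)"
      "\<forall>x i. x \<in> C \<and> i < n \<and> x i = 0 \<longrightarrow> l x i = 0"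
      "\<forall>x i. x \<in> C \<and> i < n \<and> x i = 1 \<longrightarrow> l x i = 1"
      "\<forall>x i. x \<in> C \<and> i < n \<and> l x i = 0 \<longrightarrow> x i \<le> f' x i"
      "\<forall>x i. x \<in> C \<and> i < n \<and> l x i = 1 \<longrightarrow> f' x i \<le> x i"
    by (elim exE conjE) (rule that)
  have l_le: "f x i \<ge> x i" if "x \<in> C" "i < n" "l x i = 0" for x i
    using l(4)[rule_format, of x i] that by (simp add: f'_def)
  have l_ge: "f x i \<le> x i" if "x \<in> C" "i < n" "l x i = 1" for x i
    using l(5)[rule_format, of x i] that by (simp add: f'_def)
  define grid where "grid p q = (\<lambda>i. if i < n then real (q i) / real (Suc p) else 0)" for p :: nat and q :: "nat \<Rightarrow> nat"
  have grid_C: "grid p q \<in> C" if "\<And>i. i < n \<Longrightarrow> q i \<le> Suc p" for p q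
    using that by (auto simp: grid_def C_def divide_le_eq of_nat_Suc[symmetric] simp del: of_nat_Suc)
  define cell where "cell p q r s \<longleftrightarrow> (\<forall>i<n. q i \<le> Suc p) \<and> (\<forall>i<n. grid p (r i) \<in> C \<and> grid p (s i) \<in> C \<and>
      l (grid p (r i)) i = 0 \<and> l (grid p (s i)) i = 1 \<and>
      (\<forall>j. \<bar>grid p (r i) j - grid p q j\<bar> \<le> 1 / Suc p \<and> \<bar>grid p (s i) j - grid p q j\<bar> \<le> 1 / Suc p))" for p q r s
  have "\<exists>q r s. cell p q r s" for p
  proof -
    obtain q where q: "\<forall>i<n. q i < Suc p"
      "\<forall>i<n. \<exists>r s. (\<forall>j<n. q j \<le> r j \<and> r j \<le> q j + 1) \<and> (\<forall>j<n. q j \<le> s j \<and> s j \<le> q j + 1) \<and>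
         l (grid p r) i \<noteq> l (grid p s) i"
    proof (rule kuhn_lemma[of "Suc p" n "\<lambda>q. l (grid p q)"])
      show "\<forall>x. (\<forall>i<n. x i \<le> Suc p) \<longrightarrow> (\<forall>i<n. l (grid p x) i = 0 \<or> l (grid p x) i = 1)"
        using l(1) le_eq_less_or_eq less_one by blast
      show "\<forall>x. (\<forall>i<n. x i \<le> Suc p) \<longrightarrow> (\<forall>i<n. x i = 0 \<longrightarrow> l (grid p x) i = 0)"
        by (intro allI impI l(2)[rule_format] conjI grid_C) (auto simp: grid_def)
      show "\<forall>x. (\<forall>i<n. x i \<le> Suc p) \<longrightarrow> (\<forall>i<n. x i = Suc p \<longrightarrow> l (grid p x) i = 1)"
        by (intro allI impI l(3)[rule_format] conjI grid_C) (auto simp: grid_def)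
    qed auto
    have near: "\<bar>grid p r j - grid p q j\<bar> \<le> 1 / Suc p" if "\<forall>j<n. q j \<le> r j \<and> r j \<le> q j + 1" for r j
    proof (cases "j < n")
      case True
      then have "real (r j) - real (q j) \<le> 1" "real (q j) \<le> real (r j)" using that by (force, simp)
      then show ?thesis using True
        by (simp add: grid_def diff_divide_distrib[symmetric] divide_right_mono)
    qed (simp add: grid_def)
    have "\<exists>r s. grid p r \<in> C \<and> grid p s \<in> C \<and> l (grid p r) i = 0 \<and> l (grid p s) i = 1 \<and>
      (\<forall>j. \<bar>grid p r j - grid p q j\<bar> \<le> 1 / Suc p \<and> \<bar>grid p s j - grid p q j\<bar> \<le> 1 / Suc p)" if i: "i < n" for i
    proof -
      obtain r s where rs: "\<forall>j<n. q j \<le> r j \<and> r j \<le> q j + 1" "\<forall>j<n. q j \<le> s j \<and> s j \<le> q j + 1"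
        "l (grid p r) i \<noteq> l (grid p s) i" using q(2) i by blast
      have C: "grid p r \<in> C" "grid p s \<in> C"
        using rs q(1) by (intro grid_C; force)+
      consider "l (grid p r) i = 0" "l (grid p s) i = 1" | "l (grid p s) i = 0" "l (grid p r) i = 1"
        using l(1)[rule_format, of "grid p r" i] l(1)[rule_format, of "grid p s" i] rs(3) by linarith
      then show ?thesis
        using C near[OF rs(1)] near[OF rs(2)] by cases blast+
    qed
    then obtain r s where "\<And>i. i < n \<Longrightarrow> grid p (r i) \<in> C \<and> grid p (s i) \<in> C \<and> l (grid p (r i)) i = 0 \<and> l (grid p (s i)) i = 1 \<and>
      (\<forall>j. \<bar>grid p (r i) j - grid p q j\<bar> \<le> 1 / Suc p \<and> \<bar>grid p (s i) j - grid p q j\<bar> \<le> 1 / Suc p)"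
      by metis
    then have "cell p q r s" unfolding cell_def using q(1) by auto
    then show ?thesis by blast
  qed
  then obtain q r s where qrs: "\<And>p. cell p (q p) (r p) (s p)"
    by metis
  have q: "\<And>p i. i < n \<Longrightarrow> q p i \<le> Suc p"
    and rs: "\<And>p i. i < n \<Longrightarrow> grid p (r p i) \<in> C" "\<And>p i. i < n \<Longrightarrow> grid p (s p i) \<in> C"
     "\<And>p i. i < n \<Longrightarrow> l (grid p (r p i)) i = 0" "\<And>p i. i < n \<Longrightarrow> l (grid p (s p i)) i = 1"
     "\<And>p i j. i < n \<Longrightarrow> \<bar>grid p (r p i) j - grid p (q p) j\<bar> \<le> 1 / Suc p"
     "\<And>p i j. i < n \<Longrightarrow> \<bar>grid p (s p i) j - grid p (q p) j\<bar> \<le> 1 / Suc p"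
    using qrs unfolding cell_def by blast+
  have "\<forall>p. grid p (q p) \<in> C" using grid_C q by blast
  then obtain x \<phi> where x: "x \<in> C" and \<phi>: "strict_mono \<phi>" and lim: "((\<lambda>p. grid p (q p)) \<circ> \<phi>) \<longlonglongrightarrow> x"
    using seq unfolding seq_compact_def by metis
  have limj: "(\<lambda>p. grid (\<phi> p) (q (\<phi> p)) j) \<longlonglongrightarrow> x j" for j
  proof -
    have "isCont (\<lambda>y. y j) x"
      using continuous_on_product_coordinates[of j] continuous_on_eq_continuous_at[OF open_UNIV] by blast
    then show ?thesis using lim isCont_tendsto_compose by (fastforce simp: o_def)
  qed
  have inv: "(\<lambda>p. 1 / real (Suc (\<phi> p))) \<longlonglongrightarrow> 0"
    using LIMSEQ_subseq_LIMSEQ[OF LIMSEQ_Suc[OF lim_1_over_n] \<phi>] by (simp add: o_def)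
  have lim_near: "(\<lambda>p. Y (\<phi> p)) \<longlonglongrightarrow> x"
    if "\<And>p j. \<bar>Y p j - grid p (q p) j\<bar> \<le> 1 / Suc p" for Y :: "nat \<Rightarrow> nat \<Rightarrow> real"
  proof (rule tendsto_funI)
    fix j
    have "(\<lambda>p. Y (\<phi> p) j - grid (\<phi> p) (q (\<phi> p)) j) \<longlonglongrightarrow> 0"
      by (rule Lim_null_comparison[OF _ inv]) (use that in auto)
    from tendsto_add[OF this limj[of j]] show "(\<lambda>p. Y (\<phi> p) j) \<longlonglongrightarrow> x j" by simp
  qed
  have "f x i = x i" if i: "i < n" for i
  proof (rule antisym)
    have lim_f: "(\<lambda>p. f (Y p) i - Y p i) \<longlonglongrightarrow> f x i - x i" if "Y \<longlonglongrightarrow> x" "\<And>p. Y p \<in> C" for Y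
    proof (intro tendsto_diff)
      show "(\<lambda>p. f (Y p) i) \<longlonglongrightarrow> f x i"
        using continuous_on_tendsto_compose[OF cont[OF i] that(1) x] that(2) by simp
      have "isCont (\<lambda>y. y i) x"
        using continuous_on_product_coordinates[of i] continuous_on_eq_continuous_at[OF open_UNIV] by blast
      then show "(\<lambda>p. Y p i) \<longlonglongrightarrow> x i" using that(1) isCont_tendsto_compose by fast
    qed
    have "(\<lambda>p. f (grid (\<phi> p) (r (\<phi> p) i)) i - grid (\<phi> p) (r (\<phi> p) i) i) \<longlonglongrightarrow> f x i - x i"
      using rs i by (intro lim_f lim_near) auto
    then have "0 \<le> f x i - x i"
      by (rule LIMSEQ_le_const) (use l_le rs i in auto)
    then show "x i \<le> f x i" by simp
    have "(\<lambda>p. f (grid (\<phi> p) (s (\<phi> p) i)) i - grid (\<phi> p) (s (\<phi> p) i) i) \<longlonglongrightarrow> f x i - x i"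
      using rs i by (intro lim_f lim_near) auto
    then have "f x i - x i \<le> 0"
      by (rule LIMSEQ_le_const2) (use l_ge rs i in auto)
    then show "f x i \<le> x i" by simp
  qed
  then show ?thesis using x by blast
qed

text \<open>
  Enumeration of the indices and an affine change of each coordinate reduce this to the
  unit cube.
\<close>

lemma brouwer_box:
  fixes f :: "('i \<Rightarrow> real) \<Rightarrow> 'i \<Rightarrow> real" and I :: "'i set" and e :: "'i \<Rightarrow> real"
  defines "D \<equiv> {x. \<forall>i\<in>I. \<bar>x i\<bar> \<le> e i}"
  assumes fin: "finite I" and e: "\<And>i. i \<in> I \<Longrightarrow> e i > 0"
    and cont: "\<And>i. i \<in> I \<Longrightarrow> continuous_on D (\<lambda>x. f x i)"
    and maps: "\<And>x i. x \<in> D \<Longrightarrow> i \<in> I \<Longrightarrow> \<bar>f x i\<bar> \<le> e i"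
  shows "\<exists>x\<in>D. \<forall>i\<in>I. f x i = x i"
proof -
  obtain b n where b: "bij_betw b {..<n::nat} I"
    using ex_bij_betw_nat_finite[OF fin] by (auto simp: atLeast0LessThan)
  define idx where "idx = inv_into {..<n} b"
  have idx: "idx i < n" "b (idx i) = i" if "i \<in> I" for i
    using b that unfolding idx_def bij_betw_def
    by (metis inv_into_into lessThan_iff, metis f_inv_into_f)
  have idx_b: "idx (b j) = j" "b j \<in> I" if "j < n" for j
    using b that unfolding idx_def bij_betw_def by auto
  define h where "h t = (\<lambda>i. if i \<in> I then e i * (2 * t (idx i) - 1) else 0)" for t :: "nat \<Rightarrow> real"
  define C :: "(nat \<Rightarrow> real) set" where "C = {x. \<forall>i. if i < n then x i \<in> {0..1} else x i = 0}"
  define g where "g t j = (f (h t) (b j) / e (b j) + 1) / 2" for t j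
  have hD: "h t \<in> D" if "t \<in> C" for t
  proof -
    have "\<bar>e i * (2 * t (idx i) - 1)\<bar> \<le> e i" if "i \<in> I" for i
    proof -
      have "t (idx i) \<in> {0..1}" using \<open>t \<in> C\<close> idx[OF that] unfolding C_def by (metis (mono_tags, lifting) mem_Collect_eq)
      then have "\<bar>2 * t (idx i) - 1\<bar> \<le> 1" by auto
      then show ?thesis using mult_left_mono[of _ 1 "e i"] e[OF that] by (simp add: abs_mult)
    qed
    then show ?thesis by (auto simp: D_def h_def)
  qed
  have "continuous_on S (\<lambda>t. t k)" for S :: "(nat \<Rightarrow> real) set" and k
    by (rule continuous_on_subset[OF continuous_on_product_coordinates]) simp
  then have "continuous_on C (\<lambda>t. h t i)" for i
    unfolding h_def by (cases "i \<in> I") (auto intro!: continuous_intros)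
  then have conth: "continuous_on C h"
    by (rule continuous_on_coordinatewise_then_product)
  have "\<exists>t\<in>C. \<forall>j<n. g t j = t j"
    unfolding C_def
  proof (rule brouwer_unit_cube, fold C_def)
    fix j assume j: "j < n"
    have "continuous_on C (\<lambda>t. f (h t) (b j))"
      using continuous_on_compose2[OF cont[OF idx_b(2)[OF j]] conth] hD by blast
    then show "continuous_on C (\<lambda>t. g t j)"
      unfolding g_def by (intro continuous_intros) (use e[OF idx_b(2)[OF j]] in auto)
    fix t assume "t \<in> C"
    then show "g t j \<in> {0..1}"
      using maps[OF hD, of t "b j"] idx_b(2)[OF j] e[of "b j"]
      by (auto simp: g_def abs_le_iff field_simps)
  qed
  then obtain t where t: "t \<in> C" "\<And>j. j < n \<Longrightarrow> g t j = t j" by blast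
  have "f (h t) i = h t i" if "i \<in> I" for i
    using t(2)[of "idx i"] idx[OF that] e[OF that] that by (simp add: g_def h_def field_simps)
  then show ?thesis using hD[OF t(1)] by blast
qed

text \<open>
  The equations \<open>P\<^sub>i(w\<^sub>i) = E\<^sub>i\<^sub>+\<^sub>1(w\<^sub>i\<^sub>+\<^sub>1)\<close> are a small perturbation of a trivially solvable system:
  in the coordinates in \<open>K\<close> the left side is nearly \<open>w\<^sub>i\<close> and the right side is small; in the
  other coordinates the right side is nearly \<open>w\<^sub>i\<^sub>+\<^sub>1\<close> and the left side is small. Adding the defect
  of each equation to the coordinate that it nearly determines gives a self-map of a box whose
  fixed points are the solutions.
\<close>

lemma cyclic_closing:
  fixes P E :: "nat \<Rightarrow> real^'n \<Rightarrow> real^'n" and e :: "'n \<Rightarrow> real" and K :: "'n set" and N :: nat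
  defines "D \<equiv> {w. \<forall>c. \<bar>w $ c\<bar> \<le> e c}"
  assumes e: "\<And>c. e c > 0"
    and contP: "\<And>i. i < N \<Longrightarrow> continuous_on D (P i)"
    and contE: "\<And>i. i < N \<Longrightarrow> continuous_on D (E i)"
    and P_K: "\<And>i w c. i < N \<Longrightarrow> w \<in> D \<Longrightarrow> c \<in> K \<Longrightarrow> \<bar>w $ c - P i w $ c\<bar> \<le> e c / 2"
    and E_K: "\<And>i w c. i < N \<Longrightarrow> w \<in> D \<Longrightarrow> c \<in> K \<Longrightarrow> \<bar>E i w $ c\<bar> \<le> e c / 2"
    and P_nK: "\<And>i w c. i < N \<Longrightarrow> w \<in> D \<Longrightarrow> c \<notin> K \<Longrightarrow> \<bar>P i w $ c\<bar> \<le> e c / 2"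
    and E_nK: "\<And>i w c. i < N \<Longrightarrow> w \<in> D \<Longrightarrow> c \<notin> K \<Longrightarrow> \<bar>w $ c - E i w $ c\<bar> \<le> e c / 2"
  shows "\<exists>w. \<forall>i<N. w i \<in> D \<and> P i (w i) = E (Suc i mod N) (w (Suc i mod N))"
proof -
  define sc where "sc i = Suc i mod N" for i
  define pr where "pr i = (if i = 0 then N - 1 else i - 1)" for i
  have sc: "sc i < N" "pr (sc i) = i" if "i < N" for i
    using that by (auto simp: sc_def pr_def mod_Suc)
  have pr: "pr i < N" if "i < N" for i
    using that by (auto simp: pr_def)
  define I where "I = {..<N} \<times> (UNIV :: 'n set)"
  define W where "W x i = (\<chi> c. x (i, c))" for x :: "nat \<times> 'n \<Rightarrow> real" and i
  define f where "f x = (\<lambda>(i, c). if c \<in> K then W x i $ c - P i (W x i) $ c + E (sc i) (W x (sc i)) $ c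
     else W x i $ c - E i (W x i) $ c + P (pr i) (W x (pr i)) $ c)" for x
  define B where "B = {x. \<forall>k\<in>I. \<bar>x k\<bar> \<le> e (snd k)}"
  have WD: "W x i \<in> D" if "x \<in> B" "i < N" for x i
    using that by (auto simp: W_def D_def B_def I_def)
  have "continuous_on S (\<lambda>x. x k)" for S :: "(nat \<times> 'n \<Rightarrow> real) set" and k
    by (rule continuous_on_subset[OF continuous_on_product_coordinates]) simp
  then have contW: "continuous_on B (\<lambda>x. W x i)" for i
    unfolding W_def by (intro continuous_on_vec_lambda)
  have contPW: "continuous_on B (\<lambda>x. P i (W x i))" and contEW: "continuous_on B (\<lambda>x. E i (W x i))" if "i < N" for i
    using continuous_on_compose2[OF contP[OF that] contW] continuous_on_compose2[OF contE[OF that] contW] WD that by blast+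
  have "\<exists>x\<in>B. \<forall>k\<in>I. f x k = x k"
    unfolding B_def
  proof (rule brouwer_box, fold B_def)
    show "finite I" by (simp add: I_def)
    show "e (snd k) > 0" for k :: "nat \<times> 'n" by (rule e)
    fix k assume "k \<in> I"
    then obtain i c where k: "k = (i, c)" and i: "i < N" by (auto simp: I_def)
    note lt = i sc(1)[OF i] pr[OF i]
    show "continuous_on B (\<lambda>x. f x k)"
      unfolding f_def k by (cases "c \<in> K") (simp_all, (intro continuous_intros contW contPW contEW lt)+)
    fix x assume x: "x \<in> B"
    note D = WD[OF x i] WD[OF x sc(1)[OF i]] WD[OF x pr[OF i]]
    have tri: "\<bar>a + b\<bar> \<le> r" if "\<bar>a\<bar> \<le> r / 2" "\<bar>b\<bar> \<le> r / 2" for a b r :: real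
      using that by linarith
    show "\<bar>f x k\<bar> \<le> e (snd k)"
    proof (cases "c \<in> K")
      case True
      then show ?thesis using tri[OF P_K[OF i D(1)] E_K[OF lt(2) D(2)]] by (simp add: f_def k)
    next
      case False
      then show ?thesis using tri[OF E_nK[OF i D(1)] P_nK[OF lt(3) D(3)]] by (simp add: f_def k)
    qed
  qed
  then obtain x where x: "x \<in> B" "\<And>k. k \<in> I \<Longrightarrow> f x k = x k" by blast
  have "P i (W x i) = E (sc i) (W x (sc i))" if i: "i < N" for i
  proof (subst vec_eq_iff, intro allI)
    fix c
    show "P i (W x i) $ c = E (sc i) (W x (sc i)) $ c"
    proof (cases "c \<in> K")
      case True
      then show ?thesis using x(2)[of "(i, c)"] i by (simp add: f_def I_def W_def)
    next
      case False
      then show ?thesis using x(2)[of "(sc i, c)"] sc[OF i] by (simp add: f_def I_def W_def)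
    qed
  qed
  then show ?thesis using WD[OF x(1)] unfolding sc_def by blast
qed

section \<open>Crossing of a flat disk and a graph\<close>

lemma coord_proj_add: "coord_proj K (v + w) = coord_proj K v + coord_proj K w"
  by (simp add: coord_proj_def vec_eq_iff)

lemma coord_proj_split: "coord_proj (- K) v + coord_proj K v = v"
  by (simp add: coord_proj_def vec_eq_iff)

lemma coord_proj_in_space: "coord_proj K v \<in> coord_space K"
  by (simp add: coord_proj_def coord_space_def)

lemma coord_proj_on_space: "v \<in> coord_space K \<Longrightarrow> coord_proj K v = v"
  by (auto simp: coord_proj_def coord_space_def vec_eq_iff)

lemma coord_proj_on_complement: "v \<in> coord_space (- K) \<Longrightarrow> coord_proj K v = 0"
  by (auto simp: coord_proj_def coord_space_def vec_eq_iff)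

lemma subspace_coord_space: "subspace (coord_space K)"
  by (auto simp: subspace_def coord_space_def)

lemma dim_coord_space: "dim (coord_space K) = card K"
  by (simp add: coord_space_def dim_vec_eq[symmetric] dim_substandard_cart)

lemma continuous_on_coord_proj [continuous_intros]:
  assumes "continuous_on S f"
  shows "continuous_on S (\<lambda>x. coord_proj K (f x))"
proof -
  have "continuous_on S (\<lambda>x. if i \<in> K then f x $ i else 0)" for i
    using assms by (cases "i \<in> K") (auto intro!: continuous_intros)
  then show ?thesis unfolding coord_proj_def by (intro continuous_on_vec_lambda)
qed

text \<open>
  Invariance of domain makes the image open in \<open>T\<close>; the inverse is continuous because it can be
  taken on a compact neighbourhood of \<open>b\<close>.
\<close>

lemma subspace_local_inverse:
  fixes f :: "'a::euclidean_space \<Rightarrow> 'b::euclidean_space"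
  assumes S: "subspace S" and T: "subspace T" and dim: "dim T \<le> dim S"
    and \<rho>: "\<rho> > 0" and b: "b \<in> S"
    and cont: "continuous_on (S \<inter> cball b \<rho>) f" and inj: "inj_on f (S \<inter> cball b \<rho>)"
    and into: "f ` (S \<inter> cball b \<rho>) \<subseteq> T"
  obtains \<epsilon> X where "\<epsilon> > 0" "continuous_on (T \<inter> ball (f b) \<epsilon>) X"
    "\<And>t. t \<in> T \<inter> ball (f b) \<epsilon> \<Longrightarrow> X t \<in> S \<inter> cball b \<rho> \<and> f (X t) = t" "X (f b) = b"
proof -
  let ?C = "S \<inter> cball b \<rho>" and ?O = "S \<inter> ball b \<rho>"
  have "openin (top_of_set T) (f ` ?O)"
  proof (rule invariance_of_domain_subspaces)
    show "openin (top_of_set S) ?O" by (simp add: openin_open_Int)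
    show "continuous_on ?O f" by (rule continuous_on_subset[OF cont]) auto
    show "inj_on f ?O" by (rule inj_on_subset[OF inj]) auto
    show "f \<in> ?O \<rightarrow> T" using into by auto
  qed (use S T dim in auto)
  moreover have "f b \<in> f ` ?O" using b \<rho> by auto
  ultimately obtain \<epsilon> where \<epsilon>: "\<epsilon> > 0" "ball (f b) \<epsilon> \<inter> T \<subseteq> f ` ?O"
    unfolding openin_contains_ball by blast
  define X where "X = inv_into ?C f"
  have "compact ?C" using S by (intro closed_Int_compact closed_subspace) auto
  then have contX: "continuous_on (f ` ?C) X"
    using cont inj by (intro continuous_on_inv) (auto simp: X_def)
  have sub: "T \<inter> ball (f b) \<epsilon> \<subseteq> f ` ?C" using \<epsilon>(2) ball_subset_cball by blast
  show thesis
  proof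
    show "continuous_on (T \<inter> ball (f b) \<epsilon>) X" by (rule continuous_on_subset[OF contX sub])
    show "X t \<in> ?C \<and> f (X t) = t" if "t \<in> T \<inter> ball (f b) \<epsilon>" for t
    proof -
      have "t \<in> f ` ?C" using sub that by blast
      then show ?thesis unfolding X_def by (simp add: inv_into_into f_inv_into_f del: Int_iff)
    qed
    show "X (f b) = b" using b \<rho> inj by (simp add: X_def)
  qed (rule \<epsilon>(1))
qed

lemma subspace_injective_dim_le:
  fixes f :: "'a::euclidean_space \<Rightarrow> 'b::euclidean_space"
  assumes S: "subspace S" and T: "subspace T" and \<rho>: "\<rho> > 0" and b: "b \<in> S"
    and cont: "continuous_on (S \<inter> cball b \<rho>) f" and inj: "inj_on f (S \<inter> cball b \<rho>)"
    and into: "f ` (S \<inter> cball b \<rho>) \<subseteq> T"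
  shows "dim S \<le> dim T"
proof (rule invariance_of_dimension_subspaces)
  show "openin (top_of_set S) (S \<inter> ball b \<rho>)" by (simp add: openin_open_Int)
  show "continuous_on (S \<inter> ball b \<rho>) f" by (rule continuous_on_subset[OF cont]) auto
  show "inj_on f (S \<inter> ball b \<rho>)" by (rule inj_on_subset[OF inj]) auto
  show "f \<in> S \<inter> ball b \<rho> \<rightarrow> T" using into by auto
  show "S \<inter> ball b \<rho> \<noteq> {}" using b \<rho> by auto
qed (use S T in auto)

text \<open>
  In this lemma the crossing of the invariant manifolds at a homoclinic point is put into the form required
  for the closing argument. The disk \<open>\<Phi>s(Es)\<close> is flat, contained in \<open>\<zeta> = 0\<close>, and the disk
  \<open>\<Phi>u(Eu)\<close> is a graph over the \<open>\<zeta>\<close>-directions. So \<open>\<Phi>s\<close> maps \<open>Es\<close> injectively into the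
  \<open>\<eta>\<close>-space, and the \<open>\<zeta>\<close>-part \<open>\<beta>\<close> of \<open>\<Phi>u\<close> maps \<open>Eu\<close> injectively into the \<open>\<zeta>\<close>-space.
  Invariance of domain bounds the dimensions of \<open>Es\<close> and \<open>Eu\<close> by those of the \<open>\<eta>\<close>- and \<open>\<zeta>\<close>-spaces;
  since the dimensions add up, both maps are local homeomorphisms, and their inverses \<open>X\<close>
  and \<open>Y\<close> parametrise the two subspaces by a point \<open>w = \<eta> + \<zeta>\<close> of a box. The box is made so
  thin in the \<open>\<zeta>\<close>-directions that the graph stays small over it.
\<close>

lemma topological_crossing:
  fixes Es Eu :: "(real^'n) set" and \<Phi>s \<Phi>u :: "real^'n \<Rightarrow> real^'n" and K :: "'n set"
  assumes Es: "subspace Es" and Eu: "subspace Eu" and dims: "CARD('n) \<le> dim Es + dim Eu"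
    and b: "b \<in> Es" and a: "a \<in> Eu" and \<rho>: "\<rho> > 0"
    and cs: "continuous_on (cball b \<rho>) \<Phi>s" and js: "inj_on \<Phi>s (cball b \<rho>)"
    and cu: "continuous_on (cball a \<rho>) \<Phi>u" and ju: "inj_on \<Phi>u (cball a \<rho>)"
    and b0: "\<Phi>s b = 0" and a0: "\<Phi>u a = 0"
    and flat: "\<And>x. x \<in> Es \<inter> cball b \<rho> \<Longrightarrow> coord_proj K (\<Phi>s x) = 0"
    and graph: "\<And>y. y \<in> Eu \<inter> cball a \<rho> \<Longrightarrow> \<Phi>u y = g (coord_proj K (\<Phi>u y)) + coord_proj K (\<Phi>u y)"
  obtains e :: "'n \<Rightarrow> real" and D X Y \<delta>
  where "\<And>c. e c > 0" "D = {w. \<forall>c. \<bar>w $ c\<bar> \<le> e c}" "\<delta> > 0" "\<delta> \<le> \<rho> / 2"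
    "continuous_on D X" "continuous_on D Y"
    "\<And>w. w \<in> D \<Longrightarrow> X w \<in> Es \<inter> cball b (\<rho> / 2)"
    "\<And>w. w \<in> D \<Longrightarrow> Y w \<in> Eu \<inter> cball a (\<rho> / 2)"
    "\<And>w x c. w \<in> D \<Longrightarrow> dist x (X w) \<le> \<delta> \<Longrightarrow> c \<in> K \<Longrightarrow> \<bar>\<Phi>s x $ c\<bar> \<le> e c / 2"
    "\<And>w x c. w \<in> D \<Longrightarrow> dist x (X w) \<le> \<delta> \<Longrightarrow> c \<notin> K \<Longrightarrow> \<bar>w $ c - \<Phi>s x $ c\<bar> \<le> e c / 2"
    "\<And>w y c. w \<in> D \<Longrightarrow> dist y (Y w) \<le> \<delta> \<Longrightarrow> c \<in> K \<Longrightarrow> \<bar>w $ c - \<Phi>u y $ c\<bar> \<le> e c / 2"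
    "\<And>w y c. w \<in> D \<Longrightarrow> dist y (Y w) \<le> \<delta> \<Longrightarrow> c \<notin> K \<Longrightarrow> \<bar>\<Phi>u y $ c\<bar> \<le> e c / 2"
proof -
  define \<beta> where "\<beta> y = coord_proj K (\<Phi>u y)" for y
  let ?H = "coord_space (- K)" and ?Z = "coord_space K"
  have sub: "cball b (\<rho> / 2) \<subseteq> cball b \<rho>" "cball a (\<rho> / 2) \<subseteq> cball a \<rho>" using \<rho> by auto
  have cs': "continuous_on (Es \<inter> cball b (\<rho>/2)) \<Phi>s" and js': "inj_on \<Phi>s (Es \<inter> cball b (\<rho>/2))"
    by (rule continuous_on_subset[OF cs] inj_on_subset[OF js]; use sub in blast)+
  have cu': "continuous_on (Eu \<inter> cball a (\<rho>/2)) \<Phi>u"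
    by (rule continuous_on_subset[OF cu]) (use sub in blast)
  have c\<beta>: "continuous_on (Eu \<inter> cball a (\<rho>/2)) \<beta>"
    unfolding \<beta>_def by (intro continuous_intros cu')
  have i\<beta>: "inj_on \<beta> (Eu \<inter> cball a (\<rho>/2))"
  proof (rule inj_onI)
    fix y y' assume yy: "y \<in> Eu \<inter> cball a (\<rho>/2)" "y' \<in> Eu \<inter> cball a (\<rho>/2)" "\<beta> y = \<beta> y'"
    then have "\<Phi>u y = \<Phi>u y'" using graph[of y] graph[of y'] sub unfolding \<beta>_def by (metis Int_iff subsetD)
    then show "y = y'" using ju yy sub by (auto dest!: inj_onD)
  qed
  have into_s: "\<Phi>s ` (Es \<inter> cball b (\<rho>/2)) \<subseteq> ?H"
  proof clarify
    fix x assume "x \<in> Es" "x \<in> cball b (\<rho>/2)"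
    then have "coord_proj K (\<Phi>s x) = 0" using flat sub by blast
    then show "\<Phi>s x \<in> ?H" using coord_proj_split[of K "\<Phi>s x"] coord_proj_in_space[of "- K" "\<Phi>s x"] by simp
  qed
  have into_u: "\<beta> ` (Eu \<inter> cball a (\<rho>/2)) \<subseteq> ?Z"
    using coord_proj_in_space by (auto simp: \<beta>_def)
  have \<rho>2: "\<rho> / 2 > 0" using \<rho> by simp
  have "dim Es \<le> dim ?H"
    by (rule subspace_injective_dim_le[OF Es subspace_coord_space \<rho>2 b cs' js' into_s])
  moreover have "dim Eu \<le> dim ?Z"
    by (rule subspace_injective_dim_le[OF Eu subspace_coord_space \<rho>2 a c\<beta> i\<beta> into_u])
  moreover have "dim ?H + dim ?Z = CARD('n)"
    unfolding dim_coord_space using card_Un_disjoint[of "- K" K] by simp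
  ultimately have dimH: "dim ?H \<le> dim Es" and dimZ: "dim ?Z \<le> dim Eu" using dims by linarith+
  obtain \<epsilon>1 X0 where X0: "\<epsilon>1 > 0" "continuous_on (?H \<inter> ball 0 \<epsilon>1) X0"
    "\<And>t. t \<in> ?H \<inter> ball 0 \<epsilon>1 \<Longrightarrow> X0 t \<in> Es \<inter> cball b (\<rho>/2) \<and> \<Phi>s (X0 t) = t"
    by (rule subspace_local_inverse[OF Es subspace_coord_space dimH \<rho>2 b cs' js' into_s]) (simp add: b0)
  have \<beta>a: "\<beta> a = 0" by (simp add: \<beta>_def a0 coord_proj_def vec_eq_iff)
  obtain \<epsilon>2 Y0 where Y0: "\<epsilon>2 > 0" "continuous_on (?Z \<inter> ball 0 \<epsilon>2) Y0"
    "\<And>t. t \<in> ?Z \<inter> ball 0 \<epsilon>2 \<Longrightarrow> Y0 t \<in> Eu \<inter> cball a (\<rho>/2) \<and> \<beta> (Y0 t) = t" "Y0 0 = a"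
    by (rule subspace_local_inverse[OF Eu subspace_coord_space dimZ \<rho>2 a c\<beta> i\<beta> into_u]) (simp add: \<beta>a)
  define N where "N = real CARD('n)"
  have N: "N \<ge> 1" using one_le_card_finite[where 'a='n] by (simp add: N_def)
  define \<epsilon>H where "\<epsilon>H = \<epsilon>1 / (2 * N)"
  have \<epsilon>H: "\<epsilon>H > 0" using X0(1) N by (simp add: \<epsilon>H_def)
  have c\<gamma>: "continuous_on (?Z \<inter> ball 0 \<epsilon>2) (\<lambda>t. \<Phi>u (Y0 t))"
    by (rule continuous_on_compose2[OF cu' Y0(2)]) (use Y0(3) in blast)
  have Z0: "0 \<in> ?Z \<inter> ball 0 \<epsilon>2" using Y0(1) by (simp add: coord_space_def)
  have "\<epsilon>H / 4 > 0" using \<epsilon>H by simp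
  from c\<gamma>[unfolded continuous_on_iff, rule_format, OF Z0 this]
  obtain \<epsilon>3 where \<epsilon>3: "\<epsilon>3 > 0"
    "\<And>t. t \<in> ?Z \<inter> ball 0 \<epsilon>2 \<Longrightarrow> dist t 0 < \<epsilon>3 \<Longrightarrow> dist (\<Phi>u (Y0 t)) (\<Phi>u (Y0 0)) < \<epsilon>H / 4"
    by blast
  \<comment> \<open>the \<open>\<zeta>\<close>-width is chosen after the \<open>\<eta>\<close>-width, so that the graph over it stays below \<open>\<epsilon>H / 4\<close>\<close>
  define \<epsilon>K where "\<epsilon>K = min \<epsilon>2 \<epsilon>3 / (2 * N)"
  have \<epsilon>K: "\<epsilon>K > 0" using Y0(1) \<epsilon>3(1) N by (simp add: \<epsilon>K_def)
  define e where "e c = (if c \<in> K then \<epsilon>K else \<epsilon>H)" for c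
  define D where "D = {w. \<forall>c. \<bar>w $ c\<bar> \<le> e c}"
  have small: "norm v < \<epsilon>" if "\<And>c. \<bar>v $ c\<bar> \<le> \<epsilon> / (2 * N)" "\<epsilon> > 0" for v :: "real^'n" and \<epsilon>
  proof -
    have "norm v \<le> (\<Sum>c\<in>UNIV. \<bar>v $ c\<bar>)" by (rule norm_le_l1_cart)
    also have "\<dots> \<le> (\<Sum>c\<in>(UNIV :: 'n set). \<epsilon> / (2 * N))" by (intro sum_mono that)
    also have "\<dots> = \<epsilon> / 2" using N by (simp add: N_def[symmetric] field_simps)
    finally show ?thesis using that(2) by simp
  qed
  have DH: "coord_proj (- K) w \<in> ?H \<inter> ball 0 \<epsilon>1" if "w \<in> D" for w
  proof -
    have "\<bar>coord_proj (- K) w $ c\<bar> \<le> \<epsilon>1 / (2 * N)" for c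
    proof (cases "c \<in> K")
      case True
      then show ?thesis using X0(1) N by (simp add: coord_proj_def)
    next
      case False
      have "\<bar>w $ c\<bar> \<le> e c" using that unfolding D_def by blast
      then show ?thesis using False by (simp add: coord_proj_def e_def \<epsilon>H_def)
    qed
    from small[OF this X0(1)] show ?thesis using coord_proj_in_space by simp
  qed
  have DZ: "coord_proj K w \<in> ?Z \<inter> ball 0 \<epsilon>2 \<and> norm (coord_proj K w) < \<epsilon>3" if "w \<in> D" for w
  proof -
    have "\<bar>coord_proj K w $ c\<bar> \<le> min \<epsilon>2 \<epsilon>3 / (2 * N)" for c
    proof (cases "c \<in> K")
      case True
      have "\<bar>w $ c\<bar> \<le> e c" using that unfolding D_def by blast
      then show ?thesis using True by (simp add: coord_proj_def e_def \<epsilon>K_def)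
    next
      case False
      then show ?thesis using Y0(1) \<epsilon>3(1) N by (simp add: coord_proj_def)
    qed
    from small[OF this] show ?thesis using coord_proj_in_space Y0(1) \<epsilon>3(1) by simp
  qed
  have ucs: "uniformly_continuous_on (cball b \<rho>) \<Phi>s" and ucu: "uniformly_continuous_on (cball a \<rho>) \<Phi>u"
    using cs cu by (simp_all add: compact_uniformly_continuous)
  define \<eta> where "\<eta> = min \<epsilon>K \<epsilon>H / 4"
  have \<eta>: "\<eta> > 0" using \<epsilon>K \<epsilon>H by (simp add: \<eta>_def)
  obtain \<delta>1 where \<delta>1: "\<delta>1 > 0" "\<And>x x'. x \<in> cball b \<rho> \<Longrightarrow> x' \<in> cball b \<rho> \<Longrightarrow> dist x' x < \<delta>1 \<Longrightarrow> dist (\<Phi>s x') (\<Phi>s x) < \<eta>"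
    using ucs[unfolded uniformly_continuous_on_def, rule_format, OF \<eta>] by blast
  obtain \<delta>2 where \<delta>2: "\<delta>2 > 0" "\<And>x x'. x \<in> cball a \<rho> \<Longrightarrow> x' \<in> cball a \<rho> \<Longrightarrow> dist x' x < \<delta>2 \<Longrightarrow> dist (\<Phi>u x') (\<Phi>u x) < \<eta>"
    using ucu[unfolded uniformly_continuous_on_def, rule_format, OF \<eta>] by blast
  define \<delta> where "\<delta> = min (\<rho> / 2) (min (\<delta>1 / 2) (\<delta>2 / 2))"
  have \<delta>: "\<delta> > 0" "\<delta> \<le> \<rho> / 2" "\<delta> < \<delta>1" "\<delta> < \<delta>2" using \<rho> \<delta>1(1) \<delta>2(1) by (auto simp: \<delta>_def)
  define X where "X w = X0 (coord_proj (- K) w)" for w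
  define Y where "Y w = Y0 (coord_proj K w)" for w
  have XD: "X w \<in> Es \<inter> cball b (\<rho> / 2)" "\<Phi>s (X w) = coord_proj (- K) w" if "w \<in> D" for w
    using X0(3)[OF DH[OF that]] by (simp_all add: X_def)
  have YD: "Y w \<in> Eu \<inter> cball a (\<rho> / 2)" "coord_proj K (\<Phi>u (Y w)) = coord_proj K w" if "w \<in> D" for w
    using Y0(3) DZ[OF that] by (auto simp: Y_def \<beta>_def)
  have Ysmall: "norm (\<Phi>u (Y w)) < \<epsilon>H / 4" if "w \<in> D" for w
    using \<epsilon>3(2) DZ[OF that] by (simp add: Y_def Y0(4) a0 dist_norm)
  have diff_s: "norm (\<Phi>s x - \<Phi>s (X w)) < \<eta>" if w: "w \<in> D" and x: "dist x (X w) \<le> \<delta>" for w x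
  proof -
    have "dist b (X w) \<le> \<rho> / 2" using XD(1)[OF w] by simp
    then have "x \<in> cball b \<rho>" "X w \<in> cball b \<rho>"
      using x \<delta>(2) dist_triangle[of b x "X w"] \<rho> by (auto simp: dist_commute)
    then show ?thesis using \<delta>1(2) x \<delta>(3) by (force simp: dist_norm[symmetric])
  qed
  have diff_u: "norm (\<Phi>u y - \<Phi>u (Y w)) < \<eta>" if w: "w \<in> D" and x: "dist y (Y w) \<le> \<delta>" for w y
  proof -
    have "dist a (Y w) \<le> \<rho> / 2" using YD(1)[OF w] by simp
    then have "y \<in> cball a \<rho>" "Y w \<in> cball a \<rho>"
      using x \<delta>(2) dist_triangle[of a y "Y w"] \<rho> by (auto simp: dist_commute)
    then show ?thesis using \<delta>2(2) x \<delta>(4) by (force simp: dist_norm[symmetric])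
  qed
  have ds: "\<bar>\<Phi>s x $ c - coord_proj (- K) w $ c\<bar> < \<eta>" if "w \<in> D" "dist x (X w) \<le> \<delta>" for w x c
    using component_le_norm_cart[of "\<Phi>s x - \<Phi>s (X w)" c] diff_s[OF that] XD(2)[OF that(1)] by simp
  have du: "\<bar>\<Phi>u y $ c - \<Phi>u (Y w) $ c\<bar> < \<eta>" if "w \<in> D" "dist y (Y w) \<le> \<delta>" for w y c
    using component_le_norm_cart[of "\<Phi>u y - \<Phi>u (Y w)" c] diff_u[OF that] by simp
  have uK: "\<Phi>u (Y w) $ c = w $ c" if "w \<in> D" "c \<in> K" for w c
    using arg_cong[OF YD(2)[OF that(1)], of "\<lambda>v. v $ c"] that(2) by (simp add: coord_proj_def)
  have unK: "\<bar>\<Phi>u (Y w) $ c\<bar> < \<epsilon>H / 4" if "w \<in> D" for w c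
    using component_le_norm_cart[of "\<Phi>u (Y w)" c] Ysmall[OF that] by simp
  show thesis
  proof (rule that)
    show "e c > 0" for c using \<epsilon>K \<epsilon>H by (simp add: e_def)
    show "D = {w. \<forall>c. \<bar>w $ c\<bar> \<le> e c}" by (rule D_def)
    show "continuous_on D X" unfolding X_def
      by (rule continuous_on_compose2[OF X0(2)]) (intro continuous_intros, use DH in blast)
    show "continuous_on D Y" unfolding Y_def
      by (rule continuous_on_compose2[OF Y0(2)]) (intro continuous_intros, use DZ in blast)
    fix w x y c assume w: "w \<in> D"
    show "\<bar>\<Phi>s x $ c\<bar> \<le> e c / 2" if "dist x (X w) \<le> \<delta>" "c \<in> K"
      using ds[OF w that(1), of c] that(2) \<eta> \<epsilon>K by (simp add: e_def \<eta>_def coord_proj_def)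
    show "\<bar>w $ c - \<Phi>s x $ c\<bar> \<le> e c / 2" if "dist x (X w) \<le> \<delta>" "c \<notin> K"
      using ds[OF w that(1), of c] that(2) \<eta> \<epsilon>H
      by (simp add: e_def \<eta>_def coord_proj_def abs_minus_commute[of "w $ c"])
    show "\<bar>w $ c - \<Phi>u y $ c\<bar> \<le> e c / 2" if "dist y (Y w) \<le> \<delta>" "c \<in> K"
      using du[OF w that(1), of c] uK[OF w that(2)] that(2) \<eta> \<epsilon>K
      by (simp add: e_def \<eta>_def abs_minus_commute[of "w $ c"])
    show "\<bar>\<Phi>u y $ c\<bar> \<le> e c / 2" if "dist y (Y w) \<le> \<delta>" "c \<notin> K"
    proof -
      have "\<eta> \<le> \<epsilon>H / 4" by (simp add: \<eta>_def)
      then show ?thesis using du[OF w that(1), of c] unK[OF w, of c] that(2) by (simp add: e_def)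
    qed
  qed (use \<delta> XD YD in auto)
qed

section \<open>Orbits in a linearizing chart\<close>

text \<open>
  The chart \<open>h\<close> conjugates \<open>G\<close> to the linear map \<open>B\<close> near \<open>0\<close>. The locale is instantiated both for a
  diffeomorphism and, in the same chart, for its inverse; the stable manifold of the inverse is the
  unstable manifold.
\<close>

locale linearization =
  fixes G B h k :: "'a::euclidean_space \<Rightarrow> 'a" and U :: "'a set" and r :: real
  assumes open_U: "open U" and zero_U: "0 \<in> U" and h0: "h 0 = 0" and cont_h: "continuous_on U h"
    and cont_k: "continuous_on (h ` U) k" and k_h: "\<And>x. x \<in> U \<Longrightarrow> k (h x) = x"
    and r: "r > 0" and ball_sub: "ball 0 r \<subseteq> h ` U"
    and lin: "linear B"
    and conj: "\<And>v. v \<in> ball 0 r \<Longrightarrow> G (k v) \<in> U \<and> h (G (k v)) = B v"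
begin

lemma h_k: "v \<in> ball 0 r \<Longrightarrow> h (k v) = v"
  using ball_sub k_h by fastforce

lemma k0: "k 0 = 0"
  using k_h[OF zero_U] h0 by simp

lemma cont_k_ball: "continuous_on (ball 0 r) k"
  using cont_k ball_sub by (rule continuous_on_subset)

lemma inj_k: "inj_on k (ball 0 r)"
  using h_k by (rule inj_on_inverseI)

lemma step: "v \<in> ball 0 r \<Longrightarrow> G (k v) = k (B v)"
  using conj k_h by metis

lemma iterate: "(\<And>i. i < j \<Longrightarrow> (B ^^ i) v \<in> ball 0 r) \<Longrightarrow> (G ^^ j) (k v) = k ((B ^^ j) v)"
  by (induction j) (auto simp: step)

lemma tendsto_k:
  assumes "v \<longlonglongrightarrow> 0"
  shows "(\<lambda>j. k (v j)) \<longlonglongrightarrow> 0"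
proof -
  have "isCont k 0"
    using cont_k_ball r by (simp add: continuous_on_eq_continuous_at)
  then show ?thesis using isCont_tendsto_compose[OF _ assms] k0 by metis
qed

lemma attracted_imp_stable:
  assumes "v \<in> attracted B" "\<And>i. (B ^^ i) v \<in> ball 0 r"
  shows "k v \<in> stable_manifold G 0"
  using tendsto_k[of "\<lambda>j. (B ^^ j) v"] assms iterate
  by (simp add: stable_manifold_def attracted_def)

text \<open>
  From some time on, the orbit of \<open>y\<close> stays in the ball where \<open>h\<close> is a conjugacy; read in the chart
  it is then an orbit of \<open>B\<close> that tends to \<open>0\<close>.
\<close>

lemma stable_imp_attracted:
  assumes y: "y \<in> stable_manifold G 0" and R: "R > 0"
  obtains j b where "b \<in> attracted B" "norm b < R" "(G ^^ j) y = k b"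
proof -
  have lim: "(\<lambda>j. (G ^^ j) y) \<longlonglongrightarrow> 0" using y by (simp add: stable_manifold_def)
  have "isCont h 0" using cont_h open_U zero_U by (simp add: continuous_on_eq_continuous_at)
  from isCont_tendsto_compose[OF this lim] have limh: "(\<lambda>j. h ((G ^^ j) y)) \<longlonglongrightarrow> 0" by (simp add: h0)
  have "eventually (\<lambda>j. (G ^^ j) y \<in> U) sequentially"
    using lim open_U zero_U by (rule topological_tendstoD)
  moreover have "eventually (\<lambda>j. norm (h ((G ^^ j) y)) < min R r) sequentially"
    using tendstoD[OF limh, of "min R r"] R r by simp
  ultimately have "eventually (\<lambda>j. (G ^^ j) y \<in> U \<and> norm (h ((G ^^ j) y)) < min R r) sequentially"
    by (rule eventually_conj)
  then obtain J where J: "\<And>j. j \<ge> J \<Longrightarrow> (G ^^ j) y \<in> U" "\<And>j. j \<ge> J \<Longrightarrow> norm (h ((G ^^ j) y)) < min R r"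
    unfolding eventually_sequentially by blast
  define b where "b = h ((G ^^ J) y)"
  have orbit: "h ((G ^^ (J + i)) y) = (B ^^ i) b" for i
  proof (induction i)
    case (Suc i)
    have "(G ^^ (J + i)) y = k (h ((G ^^ (J + i)) y))" using J(1)[of "J + i"] k_h by simp
    then have "h ((G ^^ (J + Suc i)) y) = h (G (k (h ((G ^^ (J + i)) y))))" by simp
    also have "\<dots> = B (h ((G ^^ (J + i)) y))" using conj J(2)[of "J + i"] by simp
    finally show ?case using Suc by simp
  qed (simp add: b_def)
  have "(\<lambda>i. (B ^^ i) b) \<longlonglongrightarrow> 0"
    using LIMSEQ_ignore_initial_segment[OF limh, of J] orbit by (simp add: add.commute)
  then have "b \<in> attracted B" by (simp add: attracted_def)
  moreover have "(G ^^ J) y = k b" using k_h J(1)[of J] by (simp add: b_def)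
  moreover have "norm b < R" using J(2)[of J] by (simp add: b_def)
  ultimately show thesis by (intro that)
qed

text \<open>
  With \<open>G'\<close> a right inverse of \<open>G\<close> and \<open>y = G'\<^sup>j(k b)\<close> a point of the stable manifold, the map
  \<open>v \<mapsto> G'\<^sup>j(k v)\<close> parametrises by a disk in the stable subspace of \<open>B\<close> a piece of the stable manifold
  through \<open>y\<close>. Points of the stable subspace of norm below \<open>R\<close> stay in the chart forever, as \<open>C R < r\<close>.
\<close>

lemma local_stable_disk:
  assumes G': "continuous_on UNIV G'" "\<And>x. G (G' x) = x"
    and c: "\<And>i v. v \<in> attracted B \<Longrightarrow> norm ((B ^^ i) v) \<le> C * norm v" and C: "C \<ge> 1" "C * R < r"
    and b: "b \<in> attracted B" "norm b < R" and S: "open S" "(G' ^^ j) (k b) \<in> S"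
  obtains \<rho> where "\<rho> > 0" "cball b \<rho> \<subseteq> ball 0 R"
    "(\<lambda>v. (G' ^^ j) (k v)) ` cball b \<rho> \<subseteq> S"
    "\<And>v. v \<in> attracted B \<inter> cball b \<rho> \<Longrightarrow> (G' ^^ j) (k v) \<in> stable_manifold G 0"
    "continuous_on (ball 0 R) (\<lambda>v. (G' ^^ j) (k v))"
proof -
  have "R > 0" using b(2) norm_ge_zero[of b] by linarith
  then have "R \<le> C * R" using C(1) by simp
  then have Rr: "ball 0 R \<subseteq> ball (0::'a) r" using C(2) by auto
  have contj: "continuous_on UNIV (G' ^^ j)"
    by (induction j) (use G'(1) in \<open>auto intro: continuous_on_compose2\<close>)
  have cont: "continuous_on (ball 0 R) (\<lambda>v. (G' ^^ j) (k v))"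
    by (rule continuous_on_compose2[OF contj continuous_on_subset[OF cont_k_ball Rr]]) auto
  have "open {v \<in> ball 0 R. (G' ^^ j) (k v) \<in> S}"
    using continuous_open_preimage[OF cont open_ball S(1)] by (simp add: vimage_def Int_def)
  moreover have "b \<in> {v \<in> ball 0 R. (G' ^^ j) (k v) \<in> S}" using b S(2) by simp
  ultimately obtain \<rho> where \<rho>: "\<rho> > 0" "cball b \<rho> \<subseteq> {v \<in> ball 0 R. (G' ^^ j) (k v) \<in> S}"
    using open_contains_cball by meson
  have stable: "(G' ^^ j) (k v) \<in> stable_manifold G 0" if v: "v \<in> attracted B \<inter> cball b \<rho>" for v
  proof -
    have nv: "norm v < R" using v \<rho>(2) by auto
    have "norm ((B ^^ i) v) < r" for i
    proof -
      have "norm ((B ^^ i) v) \<le> C * norm v" using c v by blast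
      also have "\<dots> \<le> C * R" using nv C(1) by (intro mult_left_mono) auto
      finally show ?thesis using C(2) by simp
    qed
    then have "k v \<in> stable_manifold G 0" using v by (intro attracted_imp_stable) auto
    then have "(\<lambda>i. (G ^^ (i + j)) ((G' ^^ j) (k v))) \<longlonglongrightarrow> 0"
      by (simp add: funpow_add funpow_inverse_cancel[of G G', OF G'(2)] stable_manifold_def)
    then show ?thesis unfolding stable_manifold_def mem_Collect_eq
      by (rule LIMSEQ_offset)
  qed
  show thesis
    by (rule that[of \<rho>]) (use \<rho> stable cont in auto)
qed

end

lemma unstable_manifold_eq_stable_inverse: "unstable_manifold F x = stable_manifold (inv F) x"
  by (simp add: unstable_manifold_def stable_manifold_def)

text \<open>
  In the coordinates \<open>\<xi>\<close> the first set is flat and the second one is a graph. Connected sets \<open>T\<close> stand for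
  the nested connected components of the definition: each connected subset of \<open>X1\<close> or \<open>X2\<close> near \<open>p\<close> that contains
  \<open>p\<close> lies in them. The coordinates vanish at \<open>p\<close>, since \<open>\<zeta>(p) = 0\<close> by flatness and transversality at
  \<open>p\<close> includes \<open>\<eta>(p) = 0\<close>.
\<close>

lemma quasitransversal_local:
  fixes X1 X2 :: "(real^'n) set"
  assumes "quasitransversal_at X1 X2 p"
  obtains S and \<xi> :: "real^'n \<Rightarrow> real^'n" and K and g where "open S" "p \<in> S" "continuous_on S \<xi>" "inj_on \<xi> S" "\<xi> p = 0"
    "\<And>T x. connected T \<Longrightarrow> p \<in> T \<Longrightarrow> T \<subseteq> X1 \<inter> S \<Longrightarrow> x \<in> T \<Longrightarrow> coord_proj K (\<xi> x) = 0"
    "\<And>T x. connected T \<Longrightarrow> p \<in> T \<Longrightarrow> T \<subseteq> X2 \<inter> S \<Longrightarrow> x \<in> T \<Longrightarrow>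
       \<xi> x = g (coord_proj K (\<xi> x)) + coord_proj K (\<xi> x)"
proof -
  obtain U where U: "open U" "p \<in> U" and p: "p \<in> X1" "p \<in> X2" and
    q: "\<exists>k1 k2. quasitransversal_submanifolds k1 k2 (connected_component_set (X1 \<inter> U) p) (connected_component_set (X2 \<inter> U) p) p"
    using assms unfolding quasitransversal_at_def Let_def by blast
  define W1 where "W1 = connected_component_set (X1 \<inter> U) p"
  define W2 where "W2 = connected_component_set (X2 \<inter> U) p"
  from q obtain k1 k2 where q': "quasitransversal_submanifolds k1 k2 W1 W2 p"
    unfolding W1_def W2_def by blast
  define w1 where "w1 U' = connected_component_set (W1 \<inter> U') p" for U'
  define w2 where "w2 U' = connected_component_set (W2 \<inter> U') p" for U'
  have "\<exists>U' \<xi> K. p \<in> U' \<and> C1_diffeo_on U' \<xi> \<and> card K = k2 \<and>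
      transversal_at {x \<in> U'. coord_proj (- K) (\<xi> x) = 0} (w1 U') p \<and>
      (\<forall>x\<in>w1 U'. coord_proj K (\<xi> x) = 0) \<and>
      (\<exists>\<delta> g. \<delta> > 0 \<and> (\<forall>\<zeta>. g \<zeta> \<in> coord_space (- K)) \<and>
         \<xi> ` w2 U' = {g \<zeta> + \<zeta> |\<zeta>. \<zeta> \<in> coord_space K \<and> norm \<zeta> < \<delta>} \<and>
         C1_on g {\<zeta> \<in> coord_space K. 0 < norm \<zeta> \<and> norm \<zeta> < \<delta>})"
    using q' unfolding quasitransversal_submanifolds_def Let_def w1_def w2_def by (elim conjE)
  then obtain U' \<xi> K \<delta> g where U': "p \<in> U'" and diffeo: "C1_diffeo_on U' \<xi>" and "card K = k2"
    and trans: "transversal_at {x \<in> U'. coord_proj (- K) (\<xi> x) = 0} (w1 U') p"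
    and flat: "\<forall>x\<in>w1 U'. coord_proj K (\<xi> x) = 0"
    and "\<delta> > (0 :: real)"
    and g: "\<forall>\<zeta>. g \<zeta> \<in> coord_space (- K)"
    and graph: "\<xi> ` w2 U' = {g \<zeta> + \<zeta> |\<zeta>. \<zeta> \<in> coord_space K \<and> norm \<zeta> < \<delta>}"
    and "C1_on g {\<zeta> \<in> coord_space K. 0 < norm \<zeta> \<and> norm \<zeta> < \<delta>}"
    by (elim exE conjE) (rule that)
  have p0: "coord_proj (- K) (\<xi> p) = 0" "p \<in> w1 U'"
    using trans by (auto simp: transversal_at_def)
  have in1: "T \<subseteq> w1 U'" if "connected T" "p \<in> T" "T \<subseteq> X1 \<inter> (U \<inter> U')" for T
  proof -
    have "T \<subseteq> W1" unfolding W1_def using that by (intro connected_component_maximal) auto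
    then show ?thesis unfolding w1_def using that by (intro connected_component_maximal) auto
  qed
  have in2: "T \<subseteq> w2 U'" if "connected T" "p \<in> T" "T \<subseteq> X2 \<inter> (U \<inter> U')" for T
  proof -
    have "T \<subseteq> W2" unfolding W2_def using that by (intro connected_component_maximal) auto
    then show ?thesis unfolding w2_def using that by (intro connected_component_maximal) auto
  qed
  have \<xi>: "open U'" "inj_on \<xi> U'" "continuous_on U' \<xi>"
    using diffeo unfolding C1_diffeo_on_def C1_on_def C1_deriv_on_def
    by (auto intro: has_derivative_continuous_on)
  show thesis
  proof (rule that[of "U \<inter> U'" \<xi> K g])
    show "open (U \<inter> U')" using U \<xi> by blast
    show "p \<in> U \<inter> U'" using U U' by blast
    show "continuous_on (U \<inter> U') \<xi>" using \<xi>(3) by (rule continuous_on_subset) auto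
    show "inj_on \<xi> (U \<inter> U')" using \<xi>(2) by (rule inj_on_subset) auto
    show "\<xi> p = 0" using coord_proj_split[of K "\<xi> p"] flat p0 by auto
    show "coord_proj K (\<xi> x) = 0" if "connected T" "p \<in> T" "T \<subseteq> X1 \<inter> (U \<inter> U')" "x \<in> T" for T x
      using in1[OF that(1-3)] that(4) flat by blast
    show "\<xi> x = g (coord_proj K (\<xi> x)) + coord_proj K (\<xi> x)"
      if "connected T" "p \<in> T" "T \<subseteq> X2 \<inter> (U \<inter> U')" "x \<in> T" for T x
    proof -
      have "\<xi> x \<in> {g \<zeta> + \<zeta> |\<zeta>. \<zeta> \<in> coord_space K \<and> norm \<zeta> < \<delta>}"
        using in2[OF that(1-3)] that(4) graph by blast
      then obtain \<zeta> where \<zeta>: "\<xi> x = g \<zeta> + \<zeta>" "\<zeta> \<in> coord_space K" by blast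
      then have "coord_proj K (\<xi> x) = \<zeta>"
        using g by (simp add: coord_proj_add coord_proj_on_space coord_proj_on_complement)
      then show ?thesis using \<zeta>(1) by simp
    qed
  qed
qed

section \<open>Periodic orbits that follow the homoclinic orbit\<close>

locale hyperbolic_linearization =
  s: linearization F A h k U r + u: linearization F' A' h k U r
  for F F' A A' h k :: "real^'n \<Rightarrow> real^'n" and U r +
  assumes F_F': "\<And>x. F (F' x) = x" and F'_F: "\<And>x. F' (F x) = x"
    and cont_F: "continuous_on UNIV F" and cont_F': "continuous_on UNIV F'"
    and A_A': "\<And>x. A (A' x) = x" and A'_A: "\<And>x. A' (A x) = x"
    and splitting: "\<And>v. \<exists>x\<in>attracted A. \<exists>y\<in>attracted A'. v = x + y"
begin

text \<open>
  One sequence \<open>c \<rightarrow> 0\<close> bounds the contraction of \<open>A\<close> on the stable and of \<open>A'\<close> on the unstable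
  subspace.
\<close>

definition rate :: "(nat \<Rightarrow> real) \<Rightarrow> real \<Rightarrow> bool" where
  "rate c C \<longleftrightarrow> c \<longlonglongrightarrow> 0 \<and> C \<ge> 1 \<and> (\<forall>i. 0 \<le> c i \<and> c i \<le> C) \<and>
     (\<forall>i. \<forall>x\<in>attracted A. norm ((A ^^ i) x) \<le> c i * norm x) \<and>
     (\<forall>i. \<forall>y\<in>attracted A'. norm ((A' ^^ i) y) \<le> c i * norm y)"

lemma rate_exists: "\<exists>c C. rate c C"
proof -
  obtain cs where cs: "cs \<longlonglongrightarrow> 0" "\<And>i x. x \<in> attracted A \<Longrightarrow> norm ((A ^^ i) x) \<le> cs i * norm x"
    using attracted_uniform[OF s.lin] by blast
  obtain cu where cu: "cu \<longlonglongrightarrow> 0" "\<And>i x. x \<in> attracted A' \<Longrightarrow> norm ((A' ^^ i) x) \<le> cu i * norm x"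
    using attracted_uniform[OF u.lin] by blast
  define c where "c i = \<bar>cs i\<bar> + \<bar>cu i\<bar>" for i
  have "c \<longlonglongrightarrow> \<bar>0\<bar> + \<bar>0\<bar>" unfolding c_def by (intro tendsto_intros cs cu)
  then have c: "c \<longlonglongrightarrow> 0" by simp
  then obtain C where C: "\<And>i. norm (c i) \<le> C" using convergent_imp_bounded[of c 0] bounded_pos
    by (metis (no_types, lifting) bounded_iff rangeI)
  have "rate c (max 1 C)"
    unfolding rate_def
  proof (intro conjI allI ballI)
    show "0 \<le> c i" for i by (simp add: c_def)
    show "c i \<le> max 1 C" for i using C[of i] by simp
    have le: "cs i \<le> c i" "cu i \<le> c i" for i unfolding c_def by linarith+
    show "norm ((A ^^ i) x) \<le> c i * norm x" if "x \<in> attracted A" for i x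
      using cs(2)[OF that, of i] mult_right_mono[OF le(1)[of i] norm_ge_zero[of x]] by linarith
    show "norm ((A' ^^ i) x) \<le> c i * norm x" if "x \<in> attracted A'" for i x
      using cu(2)[OF that, of i] mult_right_mono[OF le(2)[of i] norm_ge_zero[of x]] by linarith
  qed (use c in auto)
  then show ?thesis by blast
qed

lemma mixed_orbit:
  assumes "i \<le> j"
  shows "(A ^^ i) (x + (A' ^^ j) y) = (A ^^ i) x + (A' ^^ (j - i)) y"
proof -
  have "(A' ^^ j) y = (A' ^^ i) ((A' ^^ (j - i)) y)"
    using assms funpow_add[of i "j - i" A'] by simp
  then show ?thesis
    by (simp add: linear_add[OF linear_funpow[OF s.lin]] funpow_inverse_cancel[of A A', OF A_A'])
qed

text \<open>
  An orbit that enters at \<open>x + A'\<^sup>j y\<close> is close to the stable subspace first and close to the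
  unstable subspace later; the bound \<open>2 C R \<le> r\<close> keeps it in the chart for all \<open>j\<close> steps, no matter how large
  \<open>j\<close> is.
\<close>

lemma passage:
  assumes rate: "rate c C" and R: "2 * C * R \<le> r"
    and x: "x \<in> attracted A" "norm x < R" and y: "y \<in> attracted A'" "norm y < R" and ij: "i \<le> j"
  shows "(F ^^ i) (k (x + (A' ^^ j) y)) = k ((A ^^ i) x + (A' ^^ (j - i)) y)"
proof -
  have C: "C \<ge> 1" using rate by (simp add: rate_def)
  have "(A ^^ l) (x + (A' ^^ j) y) \<in> ball 0 r" if "l < i" for l
  proof -
    have "norm ((A ^^ l) x) \<le> c l * norm x" "norm ((A' ^^ (j - l)) y) \<le> c (j - l) * norm y"
      using rate x y by (auto simp: rate_def)
    moreover have "c l * norm x \<le> C * norm x" "c (j - l) * norm y \<le> C * norm y"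
      using rate by (auto simp: rate_def intro!: mult_right_mono)
    moreover have "C * norm x < C * R" "C * norm y < C * R" using C x y by auto
    ultimately have "norm ((A ^^ l) x + (A' ^^ (j - l)) y) < 2 * C * R"
      using norm_triangle_ineq[of "(A ^^ l) x" "(A' ^^ (j - l)) y"] by linarith
    then show ?thesis using R that ij by (simp add: mixed_orbit)
  qed
  then show ?thesis using s.iterate[of i "x + (A' ^^ j) y"] mixed_orbit[OF ij] by simp
qed

text \<open>
  Every cyclic sequence of sufficiently large passage times \<open>j\<^sub>i\<close> is realised by a
  periodic orbit that enters the \<open>\<rho>\<close>-ball about \<open>b\<close> at the points \<open>z\<^sub>i\<close>. Here \<open>b\<close> is an iterate of \<open>p\<close>
  on the local stable manifold, and the orbit of \<open>p\<close> needs \<open>M\<close> steps from a point \<open>a\<close> of the local unstable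
  manifold to \<open>b\<close>. The exit point \<open>A\<^sup>j x + y\<close> and the next entrance point \<open>x' + A'\<^sup>j y'\<close> must have the same image near
  \<open>p\<close>, the first under the \<open>ju\<close>-th iterate of \<open>F\<close> and the second under the \<open>js\<close>-th iterate of
  \<open>F'\<close>. In the coordinates \<open>\<xi>\<close> this is the cyclic system solved by \<open>cyclic_closing\<close>, because the
  terms \<open>A\<^sup>j x\<close> and \<open>A'\<^sup>j y'\<close> are negligible for large \<open>j\<close>.
\<close>

lemma homoclinic_chains:
  assumes quasi: "quasitransversal_at (stable_manifold F 0) (stable_manifold F' 0) p" and p: "p \<noteq> 0"
    and rate: "rate c C" and R: "R > 0" "2 * C * R \<le> r"
  obtains b M where "k b \<noteq> 0" "b \<in> attracted A" "norm b < R"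
    "\<And>\<rho>. \<rho> > 0 \<Longrightarrow> \<exists>J. \<forall>N j. (\<forall>i<N. J \<le> j i) \<longrightarrow> (\<exists>x y z. \<forall>i<N.
       x i \<in> attracted A \<and> norm (x i) < R \<and> y i \<in> attracted A' \<and> norm (y i) < R \<and>
       z i = x i + (A' ^^ j i) (y i) \<and> dist b (z i) \<le> \<rho> \<and>
       (F ^^ (j i + M)) (k (z i)) = k (z (Suc i mod N)))"
proof -
  obtain S and \<xi> :: "real^'n \<Rightarrow> real^'n" and K g where S: "open S" "p \<in> S" and \<xi>: "continuous_on S \<xi>" "inj_on \<xi> S" "\<xi> p = 0"
    and flat: "\<And>T x. connected T \<Longrightarrow> p \<in> T \<Longrightarrow> T \<subseteq> stable_manifold F 0 \<inter> S \<Longrightarrow> x \<in> T \<Longrightarrow> coord_proj K (\<xi> x) = 0"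
    and graph: "\<And>T x. connected T \<Longrightarrow> p \<in> T \<Longrightarrow> T \<subseteq> stable_manifold F' 0 \<inter> S \<Longrightarrow> x \<in> T \<Longrightarrow>
       \<xi> x = g (coord_proj K (\<xi> x)) + coord_proj K (\<xi> x)"
    by (rule quasitransversal_local[OF quasi], rule that)
  have pW: "p \<in> stable_manifold F 0" "p \<in> stable_manifold F' 0"
    using quasi by (auto simp: quasitransversal_at_def)
  have C: "C \<ge> 1" using rate by (simp add: rate_def)
  then have CR: "C * R < r" using R mult_pos_pos[of C R] by linarith
  obtain js b where b: "b \<in> attracted A" "norm b < R" "(F ^^ js) p = k b"
    using s.stable_imp_attracted[OF pW(1) R(1)] by blast
  obtain ju a where a: "a \<in> attracted A'" "norm a < R" "(F' ^^ ju) p = k a"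
    using u.stable_imp_attracted[OF pW(2) R(1)] by blast
  have pb: "p = (F' ^^ js) (k b)"
    using funpow_inverse_cancel[of F' F, OF F'_F, of js p] b(3) by simp
  have pa: "p = (F ^^ ju) (k a)"
    using funpow_inverse_cancel[of F F', OF F_F', of ju p] a(3) by simp
  have bnd_s: "norm ((A ^^ i) v) \<le> C * norm v" if "v \<in> attracted A" for i v
  proof -
    have "norm ((A ^^ i) v) \<le> c i * norm v" "c i \<le> C" using rate that by (auto simp: rate_def)
    then show ?thesis using mult_right_mono[of "c i" C "norm v"] by simp
  qed
  have bnd_u: "norm ((A' ^^ i) v) \<le> C * norm v" if "v \<in> attracted A'" for i v
  proof -
    have "norm ((A' ^^ i) v) \<le> c i * norm v" "c i \<le> C" using rate that by (auto simp: rate_def)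
    then show ?thesis using mult_right_mono[of "c i" C "norm v"] by simp
  qed
  define \<psi>s where "\<psi>s v = (F' ^^ js) (k v)" for v
  define \<psi>u where "\<psi>u v = (F ^^ ju) (k v)" for v
  obtain \<rho>1 where \<rho>1: "\<rho>1 > 0" "cball b \<rho>1 \<subseteq> ball 0 R" "\<psi>s ` cball b \<rho>1 \<subseteq> S"
    "\<And>v. v \<in> attracted A \<inter> cball b \<rho>1 \<Longrightarrow> \<psi>s v \<in> stable_manifold F 0" "continuous_on (ball 0 R) \<psi>s"
    unfolding \<psi>s_def
    by (rule s.local_stable_disk[OF cont_F' F_F' bnd_s C CR b(1,2) S(1)]) (use pb S(2) in auto)
  obtain \<rho>2 where \<rho>2: "\<rho>2 > 0" "cball a \<rho>2 \<subseteq> ball 0 R" "\<psi>u ` cball a \<rho>2 \<subseteq> S"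
    "\<And>v. v \<in> attracted A' \<inter> cball a \<rho>2 \<Longrightarrow> \<psi>u v \<in> stable_manifold F' 0" "continuous_on (ball 0 R) \<psi>u"
    unfolding \<psi>u_def
    by (rule u.local_stable_disk[OF cont_F F'_F bnd_u C CR a(1,2) S(1)]) (use pa S(2) in auto)
  have Rr: "ball 0 R \<subseteq> ball (0 :: real^'n) r"
  proof -
    have "R \<le> C * R" using C R(1) by simp
    then show ?thesis using CR by auto
  qed
  have inj_s: "inj_on \<psi>s (ball 0 R)"
    unfolding \<psi>s_def
    by (rule inj_onI) (metis Rr F_F' funpow_inverse_cancel inj_onD s.inj_k subsetD)
  have inj_u: "inj_on \<psi>u (ball 0 R)"
    unfolding \<psi>u_def
    by (rule inj_onI) (metis Rr F'_F funpow_inverse_cancel inj_onD s.inj_k subsetD)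
  note subA = subspace_attracted[OF s.lin] and subA' = subspace_attracted[OF u.lin]
  have "dim {x + y |x y. x \<in> attracted A \<and> y \<in> attracted A'} = CARD('n)"
  proof -
    have "{x + y |x y. x \<in> attracted A \<and> y \<in> attracted A'} = UNIV" using splitting by blast
    then show ?thesis by simp
  qed
  then have dims: "CARD('n) \<le> dim (attracted A) + dim (attracted A')"
    using dim_sums_Int[OF subA subA'] by linarith
  show thesis
  proof (rule that[of b "js + ju"])
    show "k b \<noteq> 0"
    proof
      assume kb: "k b = 0"
      have "F' 0 = 0" using u.step[of 0] u.r u.k0 linear_0[OF u.lin] by simp
      then have "(F' ^^ js) 0 = 0" by (induction js) auto
      then show False using pb kb p by simp
    qed
    fix \<rho>0 :: real assume \<rho>0: "\<rho>0 > 0"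
    define \<rho> where "\<rho> = min \<rho>0 (min \<rho>1 \<rho>2)"
    have \<rho>: "\<rho> > 0" "\<rho> \<le> \<rho>0" using \<rho>0 \<rho>1(1) \<rho>2(1) by (auto simp: \<rho>_def)
    have sub: "cball b \<rho> \<subseteq> cball b \<rho>1" "cball a \<rho> \<subseteq> cball a \<rho>2" by (auto simp: \<rho>_def)
    have subR: "cball b \<rho> \<subseteq> ball 0 R" "cball a \<rho> \<subseteq> ball 0 R" using sub \<rho>1(2) \<rho>2(2) by blast+
    have subS: "\<psi>s ` cball b \<rho> \<subseteq> S" "\<psi>u ` cball a \<rho> \<subseteq> S" using sub \<rho>1(3) \<rho>2(3) by blast+
    have contR: "continuous_on (cball b \<rho>) \<psi>s" "continuous_on (cball a \<rho>) \<psi>u"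
      using \<rho>1(5) \<rho>2(5) subR by (blast intro: continuous_on_subset)+
    have cs: "continuous_on (cball b \<rho>) (\<lambda>v. \<xi> (\<psi>s v))" "continuous_on (cball a \<rho>) (\<lambda>v. \<xi> (\<psi>u v))"
      using continuous_on_compose2[OF \<xi>(1) contR(1) subS(1)] continuous_on_compose2[OF \<xi>(1) contR(2) subS(2)] by auto
    have js_inj: "inj_on (\<lambda>v. \<xi> (\<psi>s v)) (cball b \<rho>)"
    proof (rule inj_onI)
      fix v v' assume v: "v \<in> cball b \<rho>" "v' \<in> cball b \<rho>" "\<xi> (\<psi>s v) = \<xi> (\<psi>s v')"
      then have "\<psi>s v = \<psi>s v'" using \<xi>(2) subS(1) by (auto dest!: inj_onD)
      then show "v = v'" using inj_s subR(1) v by (auto dest!: inj_onD)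
    qed
    have iu: "inj_on (\<lambda>v. \<xi> (\<psi>u v)) (cball a \<rho>)"
    proof (rule inj_onI)
      fix v v' assume v: "v \<in> cball a \<rho>" "v' \<in> cball a \<rho>" "\<xi> (\<psi>u v) = \<xi> (\<psi>u v')"
      then have "\<psi>u v = \<psi>u v'" using \<xi>(2) subS(2) by (auto dest!: inj_onD)
      then show "v = v'" using inj_u subR(2) v by (auto dest!: inj_onD)
    qed
    have flat': "coord_proj K (\<xi> (\<psi>s v)) = 0" if "v \<in> attracted A \<inter> cball b \<rho>" for v
    proof (rule flat[of "\<psi>s ` (attracted A \<inter> cball b \<rho>)"])
      show "connected (\<psi>s ` (attracted A \<inter> cball b \<rho>))"
        by (intro connected_continuous_image continuous_on_subset[OF contR(1)] convex_connected
            convex_Int convex_cball subspace_imp_convex subA) auto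
      show "p \<in> \<psi>s ` (attracted A \<inter> cball b \<rho>)" using b(1) \<rho>(1) pb by (auto simp: \<psi>s_def)
      show "\<psi>s ` (attracted A \<inter> cball b \<rho>) \<subseteq> stable_manifold F 0 \<inter> S" using \<rho>1(3,4) sub(1) by blast
    qed (use that in auto)
    have graph': "\<xi> (\<psi>u v) = g (coord_proj K (\<xi> (\<psi>u v))) + coord_proj K (\<xi> (\<psi>u v))"
      if "v \<in> attracted A' \<inter> cball a \<rho>" for v
    proof (rule graph[of "\<psi>u ` (attracted A' \<inter> cball a \<rho>)"])
      show "connected (\<psi>u ` (attracted A' \<inter> cball a \<rho>))"
        by (intro connected_continuous_image continuous_on_subset[OF contR(2)] convex_connected
            convex_Int convex_cball subspace_imp_convex subA') auto
      show "p \<in> \<psi>u ` (attracted A' \<inter> cball a \<rho>)" using a(1) \<rho>(1) pa by (auto simp: \<psi>u_def)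
      show "\<psi>u ` (attracted A' \<inter> cball a \<rho>) \<subseteq> stable_manifold F' 0 \<inter> S" using \<rho>2(3,4) sub(2) by blast
    qed (use that in auto)
    have b0: "\<xi> (\<psi>s b) = 0" and a0: "\<xi> (\<psi>u a) = 0" using pb pa \<xi>(3) by (simp_all add: \<psi>s_def \<psi>u_def)
    obtain e :: "'n \<Rightarrow> real" and D X Y \<delta> where e: "\<And>c. e c > 0" and D: "D = {w. \<forall>c. \<bar>w $ c\<bar> \<le> e c}"
      and \<delta>: "\<delta> > 0" "\<delta> \<le> \<rho> / 2" and cXY: "continuous_on D X" "continuous_on D Y"
      and X: "\<And>w. w \<in> D \<Longrightarrow> X w \<in> attracted A \<inter> cball b (\<rho> / 2)"
      and Y: "\<And>w. w \<in> D \<Longrightarrow> Y w \<in> attracted A' \<inter> cball a (\<rho> / 2)"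
      and est: "\<And>w x c. w \<in> D \<Longrightarrow> dist x (X w) \<le> \<delta> \<Longrightarrow> c \<in> K \<Longrightarrow> \<bar>\<xi> (\<psi>s x) $ c\<bar> \<le> e c / 2"
      "\<And>w x c. w \<in> D \<Longrightarrow> dist x (X w) \<le> \<delta> \<Longrightarrow> c \<notin> K \<Longrightarrow> \<bar>w $ c - \<xi> (\<psi>s x) $ c\<bar> \<le> e c / 2"
      "\<And>w y c. w \<in> D \<Longrightarrow> dist y (Y w) \<le> \<delta> \<Longrightarrow> c \<in> K \<Longrightarrow> \<bar>w $ c - \<xi> (\<psi>u y) $ c\<bar> \<le> e c / 2"
      "\<And>w y c. w \<in> D \<Longrightarrow> dist y (Y w) \<le> \<delta> \<Longrightarrow> c \<notin> K \<Longrightarrow> \<bar>\<xi> (\<psi>u y) $ c\<bar> \<le> e c / 2"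
      by (rule topological_crossing[OF subA subA' dims b(1) a(1) \<rho>(1) cs(1) js_inj cs(2) iu b0 a0 flat' graph'], assumption, assumption)
         (rule that)
    have "\<delta> / R > 0" using \<delta>(1) R(1) by simp
    then have "eventually (\<lambda>j. c j < \<delta> / R) sequentially"
      using rate by (auto simp: rate_def intro: order_tendstoD)
    then obtain J where J: "\<And>j. j \<ge> J \<Longrightarrow> c j < \<delta> / R" by (auto simp: eventually_sequentially)
    have XR: "norm (X w) < R" and YR: "norm (Y w) < R" if "w \<in> D" for w
    proof -
      have "X w \<in> cball b \<rho>" "Y w \<in> cball a \<rho>" using X[OF that] Y[OF that] \<rho>(1) by auto
      then show "norm (X w) < R" "norm (Y w) < R" using subR by (force simp: subset_iff)+
    qed
    have AX: "norm ((A ^^ j) (X w)) \<le> \<delta>" and AY: "norm ((A' ^^ j) (Y w)) \<le> \<delta>" if "w \<in> D" "j \<ge> J" for w j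
    proof -
      have cR: "c j * R < \<delta>" using J[OF that(2)] R(1) by (simp add: field_simps)
      have cj: "c j \<ge> 0" using rate by (simp add: rate_def)
      have "norm ((A ^^ j) (X w)) \<le> c j * norm (X w)" "norm ((A' ^^ j) (Y w)) \<le> c j * norm (Y w)"
        using rate X[OF that(1)] Y[OF that(1)] by (auto simp: rate_def)
      moreover have "c j * norm (X w) \<le> c j * R" "c j * norm (Y w) \<le> c j * R"
        using XR[OF that(1)] YR[OF that(1)] cj by (auto intro!: mult_left_mono)
      ultimately show "norm ((A ^^ j) (X w)) \<le> \<delta>" "norm ((A' ^^ j) (Y w)) \<le> \<delta>" using cR by linarith+
    qed
    show "\<exists>J. \<forall>N j. (\<forall>i<N. J \<le> j i) \<longrightarrow> (\<exists>x y z. \<forall>i<N.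
       x i \<in> attracted A \<and> norm (x i) < R \<and> y i \<in> attracted A' \<and> norm (y i) < R \<and>
       z i = x i + (A' ^^ j i) (y i) \<and> dist b (z i) \<le> \<rho>0 \<and>
       (F ^^ (j i + (js + ju))) (k (z i)) = k (z (Suc i mod N)))"
    proof (intro exI[of _ J] allI impI)
      fix N and j :: "nat \<Rightarrow> nat" assume j: "\<forall>i<N. J \<le> j i"
      define ent where "ent i w = X w + (A' ^^ j i) (Y w)" for i w
      define ext where "ext i w = (A ^^ j i) (X w) + Y w" for i w
      have ent: "dist (ent i w) (X w) \<le> \<delta>" and ext: "dist (ext i w) (Y w) \<le> \<delta>" if "w \<in> D" "i < N" for i w
        using AX[OF that(1)] AY[OF that(1)] j that(2) by (auto simp: ent_def ext_def dist_norm)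
      have entb: "ent i w \<in> cball b \<rho>" and exta: "ext i w \<in> cball a \<rho>" if "w \<in> D" "i < N" for i w
        using ent[OF that] ext[OF that] X[OF that(1)] Y[OF that(1)] \<delta>(2)
          dist_triangle[of b "ent i w" "X w"] dist_triangle[of a "ext i w" "Y w"]
        by (auto simp: dist_commute)
      have linc: "continuous_on UNIV (A ^^ m)" "continuous_on UNIV (A' ^^ m)" for m
        using linear_funpow[OF s.lin] linear_funpow[OF u.lin] linear_continuous_on linear_conv_bounded_linear by blast+
      have c_ent: "continuous_on D (ent i)" and c_ext: "continuous_on D (ext i)" for i
        unfolding ent_def ext_def
        by (intro continuous_intros cXY continuous_on_compose2[OF linc(2) cXY(2)] continuous_on_compose2[OF linc(1) cXY(1)]; simp)+
      have "\<exists>w. \<forall>i<N. w i \<in> {w. \<forall>c. \<bar>w $ c\<bar> \<le> e c} \<and>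
          \<xi> (\<psi>u (ext i (w i))) = \<xi> (\<psi>s (ent (Suc i mod N) (w (Suc i mod N))))"
      proof (rule cyclic_closing[where K = K], fold D)
        show "e c > 0" for c by (rule e)
        fix i assume i: "i < N"
        show "continuous_on D (\<lambda>w. \<xi> (\<psi>u (ext i w)))" "continuous_on D (\<lambda>w. \<xi> (\<psi>s (ent i w)))"
          using continuous_on_compose2[OF cs(2) c_ext[of i]] continuous_on_compose2[OF cs(1) c_ent[of i]]
            entb exta i by blast+
        fix w :: "real^'n" and c assume w: "w \<in> D"
        show "\<bar>w $ c - \<xi> (\<psi>u (ext i w)) $ c\<bar> \<le> e c / 2" "\<bar>\<xi> (\<psi>s (ent i w)) $ c\<bar> \<le> e c / 2" if "c \<in> K"
          using est(1)[OF w ent[OF w i] that] est(3)[OF w ext[OF w i] that] by auto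
        show "\<bar>\<xi> (\<psi>u (ext i w)) $ c\<bar> \<le> e c / 2" "\<bar>w $ c - \<xi> (\<psi>s (ent i w)) $ c\<bar> \<le> e c / 2" if "c \<notin> K"
          using est(2)[OF w ent[OF w i] that] est(4)[OF w ext[OF w i] that] by auto
      qed
      then obtain w where w: "\<And>i. i < N \<Longrightarrow> w i \<in> D"
        "\<And>i. i < N \<Longrightarrow> \<xi> (\<psi>u (ext i (w i))) = \<xi> (\<psi>s (ent (Suc i mod N) (w (Suc i mod N))))"
        unfolding D by blast
      have hop: "(F ^^ (j i + (js + ju))) (k (ent i (w i))) = k (ent (Suc i mod N) (w (Suc i mod N)))"
        if i: "i < N" for i
      proof -
        let ?i = "Suc i mod N"
        have i': "?i < N" using i by simp
        have "\<psi>u (ext i (w i)) \<in> S" "\<psi>s (ent ?i (w ?i)) \<in> S"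
          using subS entb[OF w(1)[OF i'] i'] exta[OF w(1)[OF i] i] by blast+
        then have eq: "\<psi>u (ext i (w i)) = \<psi>s (ent ?i (w ?i))"
          using \<xi>(2) w(2)[OF i] by (auto dest!: inj_onD)
        have "(F ^^ j i) (k (ent i (w i))) = k (ext i (w i))"
          using passage[OF rate R(2), of "X (w i)" "Y (w i)" "j i" "j i"] X[OF w(1)[OF i]] Y[OF w(1)[OF i]]
            XR[OF w(1)[OF i]] YR[OF w(1)[OF i]] by (simp add: ent_def ext_def)
        then have "(F ^^ (js + (ju + j i))) (k (ent i (w i))) = (F ^^ js) (\<psi>u (ext i (w i)))"
          by (simp add: funpow_add \<psi>u_def)
        also have "\<dots> = k (ent ?i (w ?i))"
          by (simp add: eq \<psi>s_def funpow_inverse_cancel[of F F', OF F_F'])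
        finally show ?thesis by (simp add: ac_simps)
      qed
      have "\<forall>i<N. X (w i) \<in> attracted A \<and> norm (X (w i)) < R \<and> Y (w i) \<in> attracted A' \<and> norm (Y (w i)) < R \<and>
         ent i (w i) = X (w i) + (A' ^^ j i) (Y (w i)) \<and> dist b (ent i (w i)) \<le> \<rho>0 \<and>
         (F ^^ (j i + (js + ju))) (k (ent i (w i))) = k (ent (Suc i mod N) (w (Suc i mod N)))"
        using w(1) X Y XR YR hop entb \<rho>(2) by (force simp: ent_def[symmetric])
      then show "\<exists>x y z. \<forall>i<N. x i \<in> attracted A \<and> norm (x i) < R \<and> y i \<in> attracted A' \<and> norm (y i) < R \<and>
         z i = x i + (A' ^^ j i) (y i) \<and> dist b (z i) \<le> \<rho>0 \<and>
         (F ^^ (j i + (js + ju))) (k (z i)) = k (z (Suc i mod N))"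
        by (intro exI[of _ "\<lambda>i. X (w i)"] exI[of _ "\<lambda>i. Y (w i)"] exI[of _ "\<lambda>i. ent i (w i)"])
    qed
  qed (rule b)+
qed

end

section \<open>Symbolic coding\<close>

context hyperbolic_linearization
begin

text \<open>
  Time is divided into slots of length \<open>L\<close>, and the orbit enters the neighbourhood \<open>B0\<close> of \<open>k b\<close> at time
  \<open>i L\<close> or \<open>i L + 1\<close>, according to the letter \<open>\<sigma> i\<close>. In the second case it is in \<open>B1 = F\<^sup>-\<^sup>1(B0)\<close> at
  time \<open>i L\<close>, and \<open>B0\<close>, \<open>B1\<close> are disjoint for a small neighbourhood because \<open>k b\<close>, a nonzero point of the stable
  manifold, is not fixed. Words start with the letter \<open>0\<close>, so that time \<open>0\<close> is an entrance; \<open>m\<close> steps later the orbit is deep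
  inside the passage near \<open>0\<close>, and so in \<open>V\<close>.
\<close>

lemma homoclinic_coding:
  assumes quasi: "quasitransversal_at (stable_manifold F 0) (stable_manifold F' 0) p" and p: "p \<noteq> 0"
    and V: "open V" "0 \<in> V"
  obtains B0 B1 m L where "compact B0" "compact B1" "B0 \<inter> B1 = {}"
    "\<And>\<sigma> N. N > 0 \<Longrightarrow> \<not> \<sigma> 0 \<Longrightarrow>
       \<exists>z. (F ^^ (N * L)) z = z \<and> (F ^^ m) z \<in> V \<and> (\<forall>i<N. (F ^^ (i * L)) z \<in> (if \<sigma> i then B1 else B0))"
    "L > 0"
proof -
  obtain c C where rate: "rate c C" using rate_exists by blast
  have C: "C \<ge> 1" using rate by (simp add: rate_def)
  define R where "R = r / (2 * C)"
  have R: "R > 0" "2 * C * R \<le> r" using s.r C by (simp_all add: R_def)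
  obtain b M where b: "k b \<noteq> 0" "b \<in> attracted A" "norm b < R"
    and chains: "\<And>\<rho>. \<rho> > 0 \<Longrightarrow> \<exists>J. \<forall>N j. (\<forall>i<N. J \<le> j i) \<longrightarrow> (\<exists>x y z. \<forall>i<N.
       x i \<in> attracted A \<and> norm (x i) < R \<and> y i \<in> attracted A' \<and> norm (y i) < R \<and>
       z i = x i + (A' ^^ j i) (y i) \<and> dist b (z i) \<le> \<rho> \<and>
       (F ^^ (j i + M)) (k (z i)) = k (z (Suc i mod N)))"
    by (rule homoclinic_chains[OF quasi p rate R], rule that)
  have Rr: "R \<le> r" using C s.r by (simp add: R_def field_simps)
  then have br: "b \<in> ball 0 r" using b(3) by simp
  have "F (k b) \<noteq> k b"
  proof
    assume fixed: "F (k b) = k b"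
    have "(F ^^ j) (k b) = k b" for j using fixed by (induction j) auto
    moreover have "norm ((A ^^ i) b) < r" for i
    proof -
      have "norm ((A ^^ i) b) \<le> c i * norm b" "c i \<le> C" using rate b(2) by (auto simp: rate_def)
      moreover have "c i * norm b \<le> C * norm b" using \<open>c i \<le> C\<close> by (intro mult_right_mono) auto
      moreover have "C * norm b < C * R" using b(3) C by simp
      moreover have "C * R \<le> 2 * C * R" using C R(1) by simp
      ultimately show ?thesis using R(2) by linarith
    qed
    then have "k b \<in> stable_manifold F 0" using b(2) by (intro s.attracted_imp_stable) auto
    ultimately have "(\<lambda>j::nat. k b) \<longlonglongrightarrow> 0" by (simp add: stable_manifold_def)
    then show False using b(1) by (simp add: LIMSEQ_const_iff)
  qed
  obtain \<rho> where \<rho>: "\<rho> > 0" "cball b \<rho> \<subseteq> ball 0 r" "F ` k ` cball b \<rho> \<inter> k ` cball b \<rho> = {}"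
  proof -
    obtain S T where ST: "open S" "open T" "F (k b) \<in> S" "k b \<in> T" "S \<inter> T = {}"
      using hausdorff[OF \<open>F (k b) \<noteq> k b\<close>] by (elim exE conjE) (rule that)
    have cFk: "continuous_on (ball 0 r) (\<lambda>v. F (k v))"
      by (rule continuous_on_compose2[OF cont_F s.cont_k_ball]) simp
    have "open {v \<in> ball 0 r. k v \<in> T}"
      using continuous_open_preimage[OF s.cont_k_ball open_ball ST(2)] by (simp add: vimage_def Int_def)
    moreover have "open {v \<in> ball 0 r. F (k v) \<in> S}"
      using continuous_open_preimage[OF cFk open_ball ST(1)] by (simp add: vimage_def Int_def)
    ultimately have "open ({v \<in> ball 0 r. k v \<in> T} \<inter> {v \<in> ball 0 r. F (k v) \<in> S})" by (rule open_Int)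
    moreover have "b \<in> {v \<in> ball 0 r. k v \<in> T} \<inter> {v \<in> ball 0 r. F (k v) \<in> S}" using br ST by simp
    ultimately obtain \<rho> where \<open>\<rho> > 0\<close> "cball b \<rho> \<subseteq> {v \<in> ball 0 r. k v \<in> T} \<inter> {v \<in> ball 0 r. F (k v) \<in> S}"
      using open_contains_cball by meson
    then have "F ` k ` cball b \<rho> \<subseteq> S" "k ` cball b \<rho> \<subseteq> T" "cball b \<rho> \<subseteq> ball 0 r" by blast+
    then show thesis using that[OF \<open>\<rho> > 0\<close>] ST(5) by blast
  qed
  obtain \<nu> where \<nu>: "\<nu> > 0" "\<And>v. norm v < \<nu> \<Longrightarrow> k v \<in> V"
  proof -
    have "open {v \<in> ball 0 r. k v \<in> V}"
      using continuous_open_preimage[OF s.cont_k_ball open_ball V(1)] by (simp add: vimage_def Int_def)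
    moreover have "0 \<in> {v \<in> ball 0 r. k v \<in> V}" using s.r s.k0 V(2) by simp
    ultimately obtain \<nu> where "\<nu> > 0" "ball 0 \<nu> \<subseteq> {v \<in> ball 0 r. k v \<in> V}"
      using open_contains_ball by meson
    then show thesis by (intro that[of \<nu>]) (auto simp: subset_iff)
  qed
  obtain J where J: "\<And>N j. (\<And>i. i < N \<Longrightarrow> J \<le> j i) \<Longrightarrow> \<exists>x y z. \<forall>i<N.
       x i \<in> attracted A \<and> norm (x i) < R \<and> y i \<in> attracted A' \<and> norm (y i) < R \<and>
       z i = x i + (A' ^^ j i) (y i) \<and> dist b (z i) \<le> \<rho> \<and>
       (F ^^ (j i + M)) (k (z i)) = k (z (Suc i mod N))"
    using chains[OF \<rho>(1)] by blast
  have "\<nu> / (2 * R) > 0" using \<nu>(1) R(1) by simp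
  then have "eventually (\<lambda>j. c j < \<nu> / (2 * R)) sequentially"
    using rate by (auto simp: rate_def intro: order_tendstoD)
  then obtain m where m: "\<And>j. j \<ge> m \<Longrightarrow> c j * R < \<nu> / 2"
    using R(1) by (auto simp: eventually_sequentially field_simps)
  \<comment> \<open>passage times are at least \<open>J\<close>, as the chains require, and at least \<open>2 m\<close>, so that \<open>m\<close> steps after the entrance both components are small\<close>
  define L where "L = J + 2 * m + M + 1"
  define B0 where "B0 = k ` cball b \<rho>"
  show thesis
  proof (rule that[of B0 "F' ` B0" L m])
    show "compact B0"
      unfolding B0_def by (intro compact_continuous_image continuous_on_subset[OF s.cont_k_ball \<rho>(2)]) simp
    then show "compact (F' ` B0)"
      by (intro compact_continuous_image continuous_on_subset[OF cont_F']) auto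
    show "B0 \<inter> F' ` B0 = {}"
    proof -
      have "F' y \<notin> B0" if "y \<in> B0" for y
      proof
        assume "F' y \<in> B0"
        then have "F (F' y) \<in> F ` B0" by (rule imageI)
        then show False using that \<rho>(3) unfolding B0_def F_F' by blast
      qed
      then show ?thesis by blast
    qed
    show "L > 0" by (simp add: L_def)
    fix \<sigma> :: "nat \<Rightarrow> bool" and N :: nat assume N: "N > 0" and \<sigma>0: "\<not> \<sigma> 0"
    define d :: "nat \<Rightarrow> nat" where "d i = (if \<sigma> (i mod N) then 1 else 0)" for i
    \<comment> \<open>the entrance times \<open>i L + d i\<close> differ by \<open>j i + M\<close>, and \<open>d i \<le> 1\<close> keeps the subtraction exact\<close>
    define j where "j i = J + 2 * m + 1 + d (Suc i) - d i" for i
    have d1: "d i \<le> 1" for i by (simp add: d_def)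
    have Jj: "J + 2 * m \<le> j i" for i using d1[of i] by (simp add: j_def)
    have jN: "j (i mod N) = j i" for i by (simp add: j_def d_def mod_Suc_eq)
    obtain x y z where xyz: "\<And>i. i < N \<Longrightarrow> x i \<in> attracted A \<and> norm (x i) < R \<and> y i \<in> attracted A' \<and> norm (y i) < R \<and>
       z i = x i + (A' ^^ j i) (y i) \<and> dist b (z i) \<le> \<rho> \<and>
       (F ^^ (j i + M)) (k (z i)) = k (z (Suc i mod N))"
      using J[of N j] add_leD1[OF Jj] by blast
    have hop: "(F ^^ (j i + M)) (k (z i)) = k (z (Suc i mod N))" if "i < N" for i
      using xyz[OF that] by (elim conjE)
    have near: "dist b (z i) \<le> \<rho>" if "i < N" for i
      using xyz[OF that] by (elim conjE)
    define \<zeta> where "\<zeta> = k (z 0)"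
    have orbit: "(F ^^ (i * L + d i)) \<zeta> = k (z (i mod N))" for i
    proof (induction i)
      case 0
      then show ?case using \<sigma>0 by (simp add: d_def \<zeta>_def)
    next
      case (Suc i)
      have "Suc i * L + d (Suc i) = (j i + M) + (i * L + d i)"
        using d1[of i] by (simp add: j_def L_def)
      then have "(F ^^ (Suc i * L + d (Suc i))) \<zeta> = (F ^^ (j (i mod N) + M)) (k (z (i mod N)))"
        by (simp only: funpow_add[of "j i + M" "i * L + d i"] comp_apply Suc.IH jN)
      also have "\<dots> = k (z (Suc (i mod N) mod N))"
        using hop N by simp
      finally show ?case by (simp add: mod_Suc_eq)
    qed
    have zB: "k (z (i mod N)) \<in> B0" for i
      using near[of "i mod N"] N by (simp add: B0_def)
    show "\<exists>z. (F ^^ (N * L)) z = z \<and> (F ^^ m) z \<in> V \<and> (\<forall>i<N. (F ^^ (i * L)) z \<in> (if \<sigma> i then F' ` B0 else B0))"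
    proof (intro exI[of _ \<zeta>] conjI allI impI)
      show "(F ^^ (N * L)) \<zeta> = \<zeta>" using orbit[of N] \<sigma>0 by (simp add: d_def \<zeta>_def)
      have mj: "m \<le> j 0" "m \<le> j 0 - m" using Jj[of 0] by linarith+
      have cx: "norm ((A ^^ m) (x 0)) < \<nu> / 2"
      proof -
        have "norm ((A ^^ m) (x 0)) \<le> c m * norm (x 0)" "0 \<le> c m"
          using rate xyz[OF N] by (auto simp: rate_def)
        moreover have "c m * norm (x 0) \<le> c m * R" using xyz[OF N] \<open>0 \<le> c m\<close> by (intro mult_left_mono) auto
        ultimately show ?thesis using m[of m] by linarith
      qed
      have cy: "norm ((A' ^^ (j 0 - m)) (y 0)) < \<nu> / 2"
      proof -
        have "norm ((A' ^^ (j 0 - m)) (y 0)) \<le> c (j 0 - m) * norm (y 0)" "0 \<le> c (j 0 - m)"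
          using rate xyz[OF N] by (auto simp: rate_def)
        moreover have "c (j 0 - m) * norm (y 0) \<le> c (j 0 - m) * R"
          using xyz[OF N] \<open>0 \<le> c (j 0 - m)\<close> by (intro mult_left_mono) auto
        ultimately show ?thesis using m[OF mj(2)] by linarith
      qed
      have "norm ((A ^^ m) (x 0) + (A' ^^ (j 0 - m)) (y 0)) < \<nu>"
        using norm_triangle_ineq[of "(A ^^ m) (x 0)" "(A' ^^ (j 0 - m)) (y 0)"] cx cy by linarith
      moreover have "(F ^^ m) \<zeta> = k ((A ^^ m) (x 0) + (A' ^^ (j 0 - m)) (y 0))"
        using passage[OF rate R(2) _ _ _ _ mj(1)] xyz[OF N] by (simp add: \<zeta>_def)
      ultimately show "(F ^^ m) \<zeta> \<in> V" using \<nu>(2) by simp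
      fix i assume i: "i < N"
      show "(F ^^ (i * L)) \<zeta> \<in> (if \<sigma> i then F' ` B0 else B0)"
      proof (cases "\<sigma> i")
        case True
        then have "F ((F ^^ (i * L)) \<zeta>) \<in> B0" using orbit[of i] zB[of i] i by (simp add: d_def)
        then have "F' (F ((F ^^ (i * L)) \<zeta>)) \<in> F' ` B0" by (rule imageI)
        then show ?thesis using True by (simp add: F'_F)
      next
        case False
        then show ?thesis using orbit[of i] zB[of i] i by (simp add: d_def)
      qed
    qed
  qed
qed

end

text \<open>
  A real vector is determined by the rational lower cuts of its coordinates, a subset of a
  countable set.
\<close>

lemma vec_set_lepoll_nat_sets: "(S :: (real^'n) set) \<lesssim> (UNIV :: nat set set)"
proof -
  define f where "f x = to_nat ` {(i :: 'n, q :: rat). of_rat q < x $ i}" for x :: "real^'n"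
  have "inj f"
  proof (rule injI)
    fix x y assume "f x = f y"
    then have eq: "{(i :: 'n, q :: rat). of_rat q < x $ i} = {(i, q). of_rat q < y $ i}"
      unfolding f_def by (simp add: inj_image_eq_iff)
    have "x $ i = y $ i" for i
    proof (rule ccontr)
      assume "x $ i \<noteq> y $ i"
      then obtain q where "x $ i < of_rat q \<and> of_rat q < y $ i \<or> y $ i < of_rat q \<and> of_rat q < x $ i"
        using of_rat_dense linorder_neqE by metis
      moreover have "of_rat q < x $ i \<longleftrightarrow> of_rat q < y $ i" using eq by (auto simp: set_eq_iff)
      ultimately show False by linarith
    qed
    then show "x = y" by (simp add: vec_eq_iff)
  qed
  then show ?thesis by (metis inj_on_subset lepoll_def subset_UNIV)
qed

text \<open>
  For the first claim take the word of length \<open>n + 2\<close> whose only letter \<open>1\<close> is at position \<open>1\<close>. If \<open>d \<le> n\<close>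
  is a period of the orbit, then so is \<open>d L\<close>, and the letters at positions \<open>1\<close> and \<open>1 + d\<close> agree,
  which is absurd. For the second claim, the periodic orbits coding longer and longer initial segments of an infinite
  word accumulate, by compactness, at an orbit that codes the whole word; different words
  give different points because \<open>B0\<close> and \<open>B1\<close> are disjoint and \<open>F\<close> is injective.
\<close>

lemma coded_periodic_orbits:
  fixes F F' :: "real^'n \<Rightarrow> real^'n"
  assumes F'_F: "\<And>x. F' (F x) = x" and cont: "continuous_on UNIV F"
    and B: "compact B0" "compact B1" "B0 \<inter> B1 = {}" and L: "L > 0"
    and code: "\<And>\<sigma> N. N > 0 \<Longrightarrow> \<not> \<sigma> 0 \<Longrightarrow>
       \<exists>z. (F ^^ (N * L)) z = z \<and> (F ^^ m) z \<in> V \<and> (\<forall>i<N. (F ^^ (i * L)) z \<in> (if \<sigma> i then B1 else B0))"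
  defines "P \<equiv> {q \<in> V. periodic_point F q}"
  shows "\<exists>q\<in>P. minimal_period F q > n" "(UNIV :: nat set set) \<lesssim> closure P"
proof -
  have inj: "x = y" if "(F ^^ i) x = (F ^^ i) y" for i x y
    using funpow_inverse_cancel[of F' F, OF F'_F] that by metis
  have contn: "continuous_on UNIV (F ^^ i)" for i
    by (induction i) (use cont in \<open>auto intro: continuous_on_compose2\<close>)
  have inP: "(F ^^ m) z \<in> P" if "(F ^^ (N * L)) z = z" "(F ^^ m) z \<in> V" "N > 0" for z N
  proof -
    have "(F ^^ (N * L)) ((F ^^ m) z) = (F ^^ m) ((F ^^ (N * L)) z)"
      by (metis add.commute comp_apply funpow_add)
    moreover have "N * L > 0" using that(3) L by simp
    ultimately have "periodic_point F ((F ^^ m) z)"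
      unfolding periodic_point_def that(1) by blast
    then show ?thesis using that(2) by (simp add: P_def)
  qed
  show "\<exists>q\<in>P. minimal_period F q > n"
  proof -
    define N where "N = n + 2"
    obtain z where z: "(F ^^ (N * L)) z = z" "(F ^^ m) z \<in> V"
      "\<And>i. i < N \<Longrightarrow> (F ^^ (i * L)) z \<in> (if i = 1 then B1 else B0)"
      using code[of N "\<lambda>i. i = 1"] by (auto simp: N_def)
    let ?q = "(F ^^ m) z" and ?d = "minimal_period F ((F ^^ m) z)"
    have q: "?q \<in> P" by (rule inP[OF z(1,2)]) (simp add: N_def)
    then have "\<exists>l>0. (F ^^ l) ?q = ?q" by (simp add: P_def periodic_point_def)
    then have d: "?d > 0 \<and> (F ^^ ?d) ?q = ?q"
      unfolding minimal_period_def by (rule LeastI_ex)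
    have "?d > n"
    proof (rule ccontr)
      assume "\<not> ?d > n"
      have "(F ^^ m) ((F ^^ ?d) z) = (F ^^ m) z" using d by (metis add.commute comp_apply funpow_add)
      then have dz: "(F ^^ ?d) z = z" by (rule inj)
      have dl: "(F ^^ (?d * l)) z = z" for l
        by (induction l) (simp_all add: funpow_add dz)
      have "(F ^^ ((1 + ?d) * L)) z = (F ^^ (1 * L)) z"
        using dl[of L] by (simp add: funpow_add)
      moreover have "(F ^^ (1 * L)) z \<in> B1" using z(3)[of 1] by (simp add: N_def)
      moreover have "(F ^^ ((1 + ?d) * L)) z \<in> B0"
        using z(3)[of "1 + ?d"] d \<open>\<not> ?d > n\<close> by (simp add: N_def)
      ultimately show False using B(3) by auto
    qed
    then show ?thesis using q by blast
  qed
  \<comment> \<open>the word of \<open>T\<close> is its characteristic sequence, shifted by one because words start with \<open>0\<close>\<close>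
  define B where "B T i = (if i > 0 \<and> i - 1 \<in> T then B1 else B0)" for T :: "nat set" and i :: nat
  have limit: "\<exists>z. (F ^^ m) z \<in> closure P \<and> (\<forall>i. (F ^^ (i * L)) z \<in> B T i)" for T
  proof -
    have "\<exists>z. (F ^^ (Suc n * L)) z = z \<and> (F ^^ m) z \<in> V \<and> (\<forall>i<Suc n. (F ^^ (i * L)) z \<in> B T i)" for n
      using code[of "Suc n" "\<lambda>i. i > 0 \<and> i - 1 \<in> T"] by (simp add: B_def)
    then obtain z where z: "\<And>n. (F ^^ (Suc n * L)) (z n) = z n" "\<And>n. (F ^^ m) (z n) \<in> V"
      "\<And>n i. i < Suc n \<Longrightarrow> (F ^^ (i * L)) (z n) \<in> B T i" by metis
    have "z n \<in> B0" for n using z(3)[of 0 n] by (simp add: B_def)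
    then obtain w \<phi> where w: "strict_mono \<phi>" "(z \<circ> \<phi>) \<longlonglongrightarrow> w"
      using B(1) unfolding compact_def by metis
    have lim: "(\<lambda>n. (F ^^ i) (z (\<phi> n))) \<longlonglongrightarrow> (F ^^ i) w" for i
      using continuous_on_tendsto_compose[OF contn w(2)] by (simp add: o_def)
    have "(F ^^ m) (z n) \<in> P" for n by (rule inP[OF z(1,2)]) simp
    then have "(F ^^ m) w \<in> closure P"
      using lim[of m] unfolding closure_sequential
      by (intro exI[of _ "\<lambda>n. (F ^^ m) (z (\<phi> n))"]) blast
    moreover have "(F ^^ (i * L)) w \<in> B T i" for i
    proof (rule Lim_in_closed_set[OF _ _ _ lim])
      show "closed (B T i)" using B by (auto simp: B_def compact_imp_closed)
      have "i < Suc (\<phi> n)" if "n \<ge> i" for n using seq_suble[OF w(1), of n] that by simp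
      then show "eventually (\<lambda>n. (F ^^ (i * L)) (z (\<phi> n)) \<in> B T i) sequentially"
        using z(3) unfolding eventually_sequentially by blast
    qed simp
    ultimately show ?thesis by blast
  qed
  then obtain z where z: "\<And>T. (F ^^ m) (z T) \<in> closure P" "\<And>T i. (F ^^ (i * L)) (z T) \<in> B T i" by metis
  have "inj (\<lambda>T. (F ^^ m) (z T))"
  proof (rule injI)
    fix T T' assume "(F ^^ m) (z T) = (F ^^ m) (z T')"
    then have eq: "z T = z T'" by (rule inj)
    have "i \<in> T \<longleftrightarrow> i \<in> T'" for i
      using z(2)[where i = "Suc i", of T] z(2)[where i = "Suc i", of T'] eq B(3) by (auto simp: B_def split: if_splits)
    then show "T = T'" by blast
  qed
  then show "(UNIV :: nat set set) \<lesssim> closure P" unfolding lepoll_def using z(1) by blast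
qed

theorem theorem3p1:
  fixes Q V :: "(real^'n) set"
    and \<F> :: "(real^'n \<Rightarrow> real^'n) set"
    and F :: "real^'n \<Rightarrow> real^'n"
    and p :: "real^'n"
  assumes "open Q" and "connected Q" and "bounded Q" and "0 \<in> Q"
    and "\<F> \<in> diffeo_space Q" and "F \<in> \<F>"
    and "hyperbolic_fixed_point F 0"
    and "C1_linearizable_at_0 F"
    and "quasitransversal_at (stable_manifold F 0) (unstable_manifold F 0) p"
    and "p \<noteq> 0"
    and "open V" and "0 \<in> V"
  shows "\<exists>P. P \<subseteq> V \<and> infinite P \<and>
           (\<forall>q\<in>P. periodic_point F q) \<and>
           (\<forall>m. \<exists>q\<in>P. minimal_period F q > m) \<and>
           closure P \<approx> (UNIV :: real set)"
proof -
  have "F \<in> absorbing_diffeos Q"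
    using assms(5,6) by (auto simp: diffeo_space_def agree_on_closure_def quotient_def)
  then have diffeo: "C1_diffeo_on UNIV F" and surj: "range F = UNIV" by (auto simp: absorbing_diffeos_def)
  have inj: "inj F" using diffeo by (simp add: C1_diffeo_on_def)
  have C1_cont: "continuous_on S f" if "C1_on f S" for f :: "real^'n \<Rightarrow> real^'n" and S
    using that unfolding C1_on_def C1_deriv_on_def by (auto intro: has_derivative_continuous_on)
  define F' where "F' = inv F"
  have cont: "continuous_on UNIV F" "continuous_on UNIV F'"
    using diffeo surj C1_cont unfolding C1_diffeo_on_def F'_def by auto
  have F_F': "F (F' x) = x" and F'_F: "F' (F x) = x" for x
    using inj surj by (simp_all add: F'_def surj_f_inv_f)
  define A where "A = frechet_derivative F (at 0)"
  have F0: "F 0 = 0" and diff: "F differentiable (at 0)"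
    and hyp: "\<And>\<mu>. complex_eigenvalue (matrix A) \<mu> \<Longrightarrow> cmod \<mu> \<noteq> 1"
    using assms(7) by (auto simp: hyperbolic_fixed_point_def jacobian_def A_def)
  have linA: "linear A" unfolding A_def by (rule linear_frechet_derivative[OF diff])
  obtain U h where U: "0 \<in> U" "C1_diffeo_on U h" "h 0 = 0"
    and conj: "\<And>x. x \<in> U \<Longrightarrow> F x \<in> U \<Longrightarrow> h (F x) = A (h x)"
    using assms(8) unfolding C1_linearizable_at_0_def A_def by blast
  define k where "k = inv_into U h"
  have h: "open U" "open (h ` U)" "inj_on h U" "continuous_on U h" "continuous_on (h ` U) k"
    using U(2) C1_cont unfolding C1_diffeo_on_def k_def by auto
  have kh: "k (h x) = x" if "x \<in> U" for x using that h(3) by (simp add: k_def)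
  have F'0: "F' 0 = 0" using F'_F[of 0] F0 by simp
  have k0: "k 0 = 0" using kh[OF U(1)] U(3) by simp
  have "continuous_on (h ` U) (\<lambda>v. F (k v))" "continuous_on (h ` U) (\<lambda>v. F' (k v))"
    by (rule continuous_on_compose2[OF cont(1) h(5)] continuous_on_compose2[OF cont(2) h(5)], simp)+
  then have o1: "open {v \<in> h ` U. F (k v) \<in> U}" "open {v \<in> h ` U. F' (k v) \<in> U}"
    using continuous_open_preimage[of "h ` U" _ U] h(1,2) by (simp_all add: vimage_def Int_def)
  have "0 \<in> h ` U" using U(1,3) by force
  then have "0 \<in> {v \<in> h ` U. F (k v) \<in> U} \<inter> {v \<in> h ` U. F' (k v) \<in> U}" using k0 F0 F'0 U(1) by simp
  then obtain r where r: "r > 0" "ball 0 r \<subseteq> {v \<in> h ` U. F (k v) \<in> U} \<inter> {v \<in> h ` U. F' (k v) \<in> U}"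
    using open_Int[OF o1] open_contains_ball by meson
  have ball: "k v \<in> U \<and> h (k v) = v \<and> F (k v) \<in> U \<and> F' (k v) \<in> U" if "v \<in> ball 0 r" for v
    using r(2) that kh by fastforce
  have conjF: "h (F (k v)) = A v" if "v \<in> ball 0 r" for v
    using conj ball[OF that] by auto
  have "v = 0" if "A v = 0" for v
  proof (rule ccontr)
    assume "v \<noteq> 0"
    \<comment> \<open>the conjugacy transports the injectivity of \<open>F\<close> to \<open>A\<close>; by scaling it is enough to look at small vectors\<close>
    define w where "w = (r / (2 * norm v)) *\<^sub>R v"
    have w: "w \<in> ball 0 r" "w \<noteq> 0" using \<open>v \<noteq> 0\<close> r(1) by (auto simp: w_def)
    have "A w = 0" using that by (simp add: w_def linear_cmul[OF linA])
    then have "h (F (k w)) = h 0" using conjF[OF w(1)] U(3) by simp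
    then have "F (k w) = F 0" using ball[OF w(1)] U(1) h(3) F0 by (auto dest!: inj_onD)
    then have "k w = 0" using inj by (auto dest!: injD)
    then show False using ball[OF w(1)] U(3) w(2) by auto
  qed
  then have injA: "inj A" using linear_injective_0[OF linA] by blast
  then have surjA: "surj A" using linear_injective_imp_surjective[OF linA] by blast
  define A' where "A' = inv A"
  have A_A': "A (A' x) = x" and A'_A: "A' (A x) = x" for x
    using injA surjA by (simp_all add: A'_def surj_f_inv_f)
  have linA': "linear A'" unfolding A'_def by (rule inj_linear_imp_inv_linear[OF linA injA])
  have conjF': "h (F' (k v)) = A' v" if "v \<in> ball 0 r" for v
    \<comment> \<open>the conjugacy relation is applied at the preimage \<open>F' (k v)\<close>, which the choice of \<open>r\<close> keeps in \<open>U\<close>\<close>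
    using conj[of "F' (k v)"] ball[OF that] A'_A[of "h (F' (k v))"] by (simp add: F_F')
  have sub: "ball 0 r \<subseteq> h ` U" using r(2) by blast
  interpret s: linearization F A h k U r
    by (rule linearization.intro[OF h(1) U(1,3) h(4,5) kh r(1) sub linA]) (use ball conjF in simp_all)
  interpret u: linearization F' A' h k U r
    by (rule linearization.intro[OF h(1) U(1,3) h(4,5) kh r(1) sub linA']) (use ball conjF' in simp_all)
  have split: "\<exists>x\<in>attracted A. \<exists>y\<in>attracted A'. v = x + y" for v
    by (rule hyperbolic_splitting[OF linA linA' A_A' A'_A]) (use hyp in blast)
  interpret hyperbolic_linearization F F' A A' h k U r
    by unfold_locales (fact F_F' F'_F cont A_A' A'_A split)+
  have quasi: "quasitransversal_at (stable_manifold F 0) (stable_manifold F' 0) p"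
    using assms(9) by (simp add: unstable_manifold_eq_stable_inverse F'_def)
  obtain B0 B1 m L where code: "compact B0" "compact B1" "B0 \<inter> B1 = {}"
    "\<And>\<sigma> N. N > 0 \<Longrightarrow> \<not> \<sigma> 0 \<Longrightarrow>
       \<exists>z. (F ^^ (N * L)) z = z \<and> (F ^^ m) z \<in> V \<and> (\<forall>i<N. (F ^^ (i * L)) z \<in> (if \<sigma> i then B1 else B0))" "L > 0"
    by (rule homoclinic_coding[OF quasi assms(10-12)], rule that)
  define P where "P = {q \<in> V. periodic_point F q}"
  have long: "\<exists>q\<in>P. minimal_period F q > n" for n
    unfolding P_def by (rule coded_periodic_orbits(1)[OF F'_F cont(1) code(1-3,5,4)])
  have "(UNIV :: nat set set) \<lesssim> closure P"
    unfolding P_def by (rule coded_periodic_orbits(2)[OF F'_F cont(1) code(1-3,5,4)])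
  then have "closure P \<approx> (UNIV :: nat set set)"
    using vec_set_lepoll_nat_sets lepoll_antisym by blast
  then have "closure P \<approx> (UNIV :: real set)"
    using nat_sets_eqpoll_reals eqpoll_trans by blast
  moreover have "infinite P"
  proof
    assume "finite P"
    obtain q where "q \<in> P" "minimal_period F q > Max (minimal_period F ` P)" using long by blast
    then show False using \<open>finite P\<close> by (simp add: Max_ge leD)
  qed
  ultimately show ?thesis using long by (intro exI[of _ P]) (auto simp: P_def)
qed

end
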